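(* For every finite simple undirected graph $G$, the matching $R$ output by the \textsc{Ranking} algorithm on $G$ satisfies $\mathbb{E}[|R|] \geq 0.505\cdot \mu(G)$, where $\mu(G)$ is the maximum size of a matching in $G$ and the expectation is over the random permutation chosen by the algorithm. That is, the expected approximation ratio of \textsc{Ranking} is at least $0.505$ in general graphs.
   Context: The \textsc{Ranking} algorithm on a graph $G=(V,E)$: draw a permutation $\pi$ of $V$ uniformly at random; iterate over the vertices in the order of $\pi$, and when processing a vertex that is still unmatched, match it to its first (in the order of $\pi$) currently unmatched neighbor, if any. The output $R$ is the resulting matching, which is maximal. *)

theory Defs
  imports
    "HOL-Combinatorics.Multiset_Permutations"
    "HOL-Probability.Probability_Mass_Function"
begin

definition finite_simple_graph :: "'a set \<Rightarrow> 'a set set \<Rightarrow> bool" where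
  "finite_simple_graph V E \<longleftrightarrow> finite V \<and> (\<forall>e\<in>E. e \<subseteq> V \<and> card e = 2)"

definition matching :: "'a set set \<Rightarrow> 'a set set \<Rightarrow> bool" where
  "matching E M \<longleftrightarrow> M \<subseteq> E \<and> pairwise disjnt M"

definition matching_number :: "'a set set \<Rightarrow> nat" where
  "matching_number E = Max {card M | M. matching E M}"

text \<open>A permutation of the vertices is the list of vertices in the order in which they are
  processed. The vertices matched so far are those in \<open>\<Union>M\<close>, and \<^const>\<open>find\<close> returns the first
  element of the list satisfying a predicate. The search runs over all of \<open>\<pi>\<close>, including
  vertices that have already been processed; \<open>v\<close> itself is never found as \<open>E\<close> has no loops.\<close>

definition ranking_step :: "'a set set \<Rightarrow> 'a list \<Rightarrow> 'a \<Rightarrow> 'a set set \<Rightarrow> 'a set set" where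
  "ranking_step E \<pi> v M =
     (if v \<in> \<Union>M then M
      else case find (\<lambda>u. {v, u} \<in> E \<and> u \<notin> \<Union>M) \<pi> of
             None \<Rightarrow> M
           | Some u \<Rightarrow> insert {v, u} M)"

definition ranking :: "'a set set \<Rightarrow> 'a list \<Rightarrow> 'a set set" where
  "ranking E \<pi> = fold (ranking_step E \<pi>) \<pi> {}"

lemma ranking_step_mono: "M \<subseteq> ranking_step E \<pi> v M"
  by (simp add: ranking_step_def subset_insertI split: option.split)

lemma fold_ranking_step_mono: "M \<subseteq> fold (ranking_step E \<pi>) xs M"
proof (induction xs arbitrary: M)
  case (Cons x xs)
  show ?case
    using ranking_step_mono[of M E \<pi> x] Cons.IH[of "ranking_step E \<pi> x M"] by auto
qed simp

lemma matching_ranking_step: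
  assumes "matching E M"
  shows "matching E (ranking_step E \<pi> v M)"
proof (cases "find (\<lambda>u. {v, u} \<in> E \<and> u \<notin> \<Union>M) \<pi>")
  case None
  with assms show ?thesis by (simp add: ranking_step_def)
next
  case (Some u)
  then have u: "{v, u} \<in> E" "u \<notin> \<Union>M"
    unfolding find_Some_iff by blast+
  have "matching E (insert {v, u} M)" if v: "v \<notin> \<Union>M"
  proof -
    have "disjnt {v, u} e" "disjnt e {v, u}" if "e \<in> M" for e
      using that u(2) v by (auto simp: disjnt_def)
    with assms u(1) show ?thesis
      unfolding matching_def pairwise_insert by blast
  qed
  with assms Some show ?thesis by (simp add: ranking_step_def)
qed

lemma matching_fold_ranking_step:
  "matching E M \<Longrightarrow> matching E (fold (ranking_step E \<pi>) xs M)"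
  by (induction xs arbitrary: M) (auto intro: matching_ranking_step)

lemma matching_ranking: "matching E (ranking E \<pi>)"
  unfolding ranking_def
  by (rule matching_fold_ranking_step) (simp add: matching_def)

lemma fold_ranking_step_covers:
  assumes "v \<in> set xs" "{v, u} \<in> E" "u \<in> set \<pi>"
  shows "v \<in> \<Union>(fold (ranking_step E \<pi>) xs M) \<or> u \<in> \<Union>(fold (ranking_step E \<pi>) xs M)"
  using assms(1)
proof (induction xs arbitrary: M)
  case (Cons x xs)
  show ?case
  proof (cases "x = v")
    case True
    have "v \<in> \<Union>(ranking_step E \<pi> v M) \<or> u \<in> \<Union>(ranking_step E \<pi> v M)"
    proof (cases "find (\<lambda>u. {v, u} \<in> E \<and> u \<notin> \<Union>M) \<pi>")
      case None
      with assms(2,3) have "u \<in> \<Union>M" unfolding find_None_iff by blast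
      then show ?thesis using ranking_step_mono[of M E \<pi> v] by blast
    next
      case (Some w)
      then show ?thesis by (simp add: ranking_step_def)
    qed
    then show ?thesis
      using Union_mono[OF fold_ranking_step_mono[of "ranking_step E \<pi> v M" E \<pi> xs]] True
      by (metis fold_simps(2) subsetD)
  next
    case False
    with Cons.prems have "v \<in> set xs" by simp
    then show ?thesis using Cons.IH[of "ranking_step E \<pi> x M"] by simp
  qed
qed simp

lemma ranking_maximal:
  assumes "finite_simple_graph V E" "set \<pi> = V" "e \<in> E"
  shows "e \<inter> \<Union>(ranking E \<pi>) \<noteq> {}"
proof -
  from assms(1,3) have "card e = 2" "e \<subseteq> V"
    by (auto simp: finite_simple_graph_def)
  then obtain v u where "e = {v, u}" "v \<in> V" "u \<in> V"
    by (auto simp: card_2_iff)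
  with assms(2,3) fold_ranking_step_covers[of v \<pi> u E \<pi> "{}"] show ?thesis
    by (auto simp: ranking_def)
qed

end

(* Fix a maximum matching M*. As R is maximal, every edge of M* has a matched endpoint, so it suffices
   that a constant fraction of the edges of M* has both endpoints matched. Give the vertices independent
   ranks, and let the gap of an edge of R be the difference of the ranks of its endpoints.

   Large gaps help: if c chooses u, and the partner d of c in M* is unmatched, then moving d to any rank
   between those of c and u produces a run in which both c and d are matched. Resampling the rank of d,
   the expected gap of such edges is at most the expected number of edges of M* with both ends matched.

   Gaps are large: for an edge {c, d} of M*, look at the run without c and d, and at the ranks up to which
   d has at least two (at least one) neighbours that are still free. Adding one vertex changes the set of
   free vertices by at most one element at any time. Hence if c and d both come early, both find a partner;
   otherwise, the edge of R at one of them must bridge a gap comparable with the distances of the ranks of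
   c and d from each other and from these thresholds. *)

theory Submission
  imports Defs
begin

text \<open>The moving argument works only if \<open>c\<close> is the endpoint that chooses. A gap
  at a vertex that was chosen is therefore booked on its chooser. If that chooser lies outside the
  maximum matching, it is an extra matched vertex and enlarges the output directly; if its partner
  is matched as well, its edge is already one of the wanted ones; otherwise the moving argument
  applies to it. The thresholds come from the run without \<open>c\<close> and \<open>d\<close>, so
  they do not react when both ranks are resampled. With all other ranks fixed, the forced gap is an
  explicit piecewise linear function of the two ranks, and the lower bound becomes an integral over
  a square, minimised over the thresholds. Its minimum is 5/108 of the rank range. The area where
  both vertices are early enough to be matched for certain competes with the area where gaps are
  forced. Ranks are integers below \<open>N\<close>, so probabilities are counts and integrals are
  sums; ties and rounding cost lower-order terms that vanish as \<open>N\<close> grows.\<close>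

section \<open>The process as a decreasing set of free vertices\<close>

text \<open>Instead of a permutation, the process is driven by an injective key function \<open>k\<close>, and the vertex
  of key \<open>t\<close> is processed at time \<open>t\<close>. \<open>remaining E k W t\<close> is the set of vertices of \<open>W\<close> that are
  neither processed nor matched before time \<open>t\<close>. Vertices that were processed without success may be
  dropped: their neighbours are all matched already.\<close>

definition first_nbr :: "'a set set \<Rightarrow> ('a \<Rightarrow> nat) \<Rightarrow> 'a set \<Rightarrow> 'a \<Rightarrow> 'a \<Rightarrow> bool" where
  "first_nbr E k S x y \<longleftrightarrow> y \<in> S \<and> {x, y} \<in> E \<and> (\<forall>z\<in>S. {x, z} \<in> E \<longrightarrow> k y \<le> k z)"

definition ranking_sweep :: "'a set set \<Rightarrow> ('a \<Rightarrow> nat) \<Rightarrow> nat \<Rightarrow> 'a set \<Rightarrow> 'a set" where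
  "ranking_sweep E k t S = {v\<in>S. k v \<noteq> t \<and> \<not> (\<exists>x\<in>S. k x = t \<and> first_nbr E k S x v)}"

primrec remaining :: "'a set set \<Rightarrow> ('a \<Rightarrow> nat) \<Rightarrow> 'a set \<Rightarrow> nat \<Rightarrow> 'a set" where
  "remaining E k W 0 = W"
| "remaining E k W (Suc t) = ranking_sweep E k t (remaining E k W t)"

definition chooses :: "'a set set \<Rightarrow> ('a \<Rightarrow> nat) \<Rightarrow> 'a set \<Rightarrow> 'a \<Rightarrow> 'a \<Rightarrow> bool" where
  "chooses E k W x y \<longleftrightarrow>
     x \<in> remaining E k W (k x) \<and> first_nbr E k (remaining E k W (k x)) x y"

definition matched :: "'a set set \<Rightarrow> ('a \<Rightarrow> nat) \<Rightarrow> 'a set \<Rightarrow> 'a \<Rightarrow> bool" where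
  "matched E k W v \<longleftrightarrow> (\<exists>y. chooses E k W v y \<or> chooses E k W y v)"

lemma remaining_antimono: "t \<le> t' \<Longrightarrow> remaining E k W t' \<subseteq> remaining E k W t"
  by (induction t' rule: dec_induct) (auto simp: ranking_sweep_def)

lemma remaining_subset: "remaining E k W t \<subseteq> W"
  using remaining_antimono[of 0 t E k W] by simp

lemma remaining_key: "v \<in> remaining E k W t \<Longrightarrow> t \<le> k v"
proof (induction t)
  case (Suc t)
  then have "v \<in> remaining E k W t" "k v \<noteq> t" by (auto simp: ranking_sweep_def)
  with Suc.IH show ?case by simp
qed simp

lemma remaining_exit:
  assumes "v \<in> W" "v \<notin> remaining E k W t" "t \<le> k v"
  obtains x where "chooses E k W x v" "k x < t"
proof -
  have "\<exists>x. chooses E k W x v \<and> k x < t"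
    using assms(2,3)
  proof (induction t)
    case (Suc t)
    show ?case
    proof (cases "v \<in> remaining E k W t")
      case True
      with Suc.prems obtain x where
        "x \<in> remaining E k W t" "k x = t" "first_nbr E k (remaining E k W t) x v"
        by (auto simp: ranking_sweep_def)
      then show ?thesis by (auto simp: chooses_def)
    qed (use Suc in force)
  qed (use assms(1) in simp)
  then show thesis using that by blast
qed

lemma ranking_sweep_cong:
  assumes "\<And>v. v \<in> S \<Longrightarrow> k v = k' v"
  shows "ranking_sweep E k t S = ranking_sweep E k' t S"
proof -
  have "first_nbr E k S x y \<longleftrightarrow> first_nbr E k' S x y" for x y
    using assms by (auto simp: first_nbr_def)
  then show ?thesis using assms by (auto simp: ranking_sweep_def)
qed

lemma remaining_cong:
  assumes "\<And>v. v \<in> W \<Longrightarrow> k v = k' v"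
  shows "remaining E k W t = remaining E k' W t"
proof (induction t)
  case (Suc t)
  have "k v = k' v" if "v \<in> remaining E k' W t" for v
    using assms that subsetD[OF remaining_subset that] by blast
  then show ?case
    unfolding remaining.simps Suc.IH by (rule ranking_sweep_cong)
qed simp

locale loopless =
  fixes E :: "'a set set"
  assumes no_loop: "{x, x} \<notin> E"
begin

lemma chooses_remaining:
  assumes "chooses E k W x y"
  shows "x \<in> remaining E k W (k x)" "y \<in> remaining E k W (k x)" "{x, y} \<in> E" "x \<in> W" "y \<in> W" "x \<noteq> y"
  using assms no_loop by (auto simp: chooses_def first_nbr_def dest: remaining_subset[THEN subsetD])

lemma chooses_less:
  assumes "inj_on k W" "chooses E k W x y"
  shows "k x < k y"
  using chooses_remaining[OF assms(2)] remaining_key[of y E k W "k x"] assms(1)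
  by (metis inj_onD nless_le)

lemma chooses_gone:
  assumes "chooses E k W x y" "k x < t"
  shows "x \<notin> remaining E k W t" "y \<notin> remaining E k W t"
proof -
  have "x \<notin> remaining E k W (Suc (k x))" "y \<notin> remaining E k W (Suc (k x))"
    using assms(1) by (auto simp: chooses_def ranking_sweep_def)
  then show "x \<notin> remaining E k W t" "y \<notin> remaining E k W t"
    using remaining_antimono[of "Suc (k x)" t E k W] assms(2) by auto
qed

lemma chooses_fun:
  assumes "inj_on k W" "chooses E k W x y" "chooses E k W x y'"
  shows "y = y'"
proof -
  have "k y = k y'" using assms(2,3) by (auto simp: chooses_def first_nbr_def intro: antisym)
  with assms(1) show ?thesis
    using chooses_remaining[OF assms(2)] chooses_remaining[OF assms(3)] by (auto dest: inj_onD)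
qed

lemma passive_matched:
  assumes "v \<in> W" "v \<notin> remaining E k W (k v)"
  shows "matched E k W v"
  using remaining_exit[OF assms] by (auto simp: matched_def)

lemma active_chooses:
  assumes "x \<in> remaining E k W (k x)" "z \<in> remaining E k W (k x)" "{x, z} \<in> E"
  obtains y where "chooses E k W x y"
proof -
  let ?P = "\<lambda>y. y \<in> remaining E k W (k x) \<and> {x, y} \<in> E"
  obtain y where "?P y" "\<forall>z. ?P z \<longrightarrow> k y \<le> k z"
    using ex_has_least_nat[of ?P z k] assms by blast
  then show thesis using that assms(1) by (auto simp: chooses_def first_nbr_def)
qed

lemma matched_of_remaining_nbr:
  assumes "x \<in> W" "z \<in> remaining E k W (k x)" "{x, z} \<in> E"
  shows "matched E k W x"
  using assms active_chooses[of x k W z] passive_matched[of x W k] unfolding matched_def by blast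

lemma matched_maximal:
  assumes "{u, v} \<in> E" "u \<in> W" "v \<in> W"
  shows "matched E k W u \<or> matched E k W v"
proof -
  have *: "matched E k W u \<or> matched E k W v"
    if "{u, v} \<in> E" "u \<in> W" "v \<in> W" "k u \<le> k v" for u v
  proof (cases "v \<in> remaining E k W (k v)")
    case True
    then have "v \<in> remaining E k W (k u)" by (rule subsetD[OF remaining_antimono[OF that(4)]])
    then show ?thesis using matched_of_remaining_nbr[of u W v k] that by simp
  qed (use passive_matched[of v W k] that in simp)
  show ?thesis using *[of u v] *[of v u] assms by (cases "k u \<le> k v") (auto simp: insert_commute)
qed

lemma unmatched_remaining:
  assumes "v \<in> W" "\<not> matched E k W v" "t \<le> k v"
  shows "v \<in> remaining E k W t"
  using assms(1,2) passive_matched[of v W k] subsetD[OF remaining_antimono[OF assms(3), of E k W], of v] by blast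

section \<open>Stability of the free set when one vertex is added\<close>

lemma sweep_none: "(\<And>x. x \<in> S \<Longrightarrow> k x \<noteq> t) \<Longrightarrow> ranking_sweep E k t S = S"
  by (auto simp: ranking_sweep_def)

lemma sweep_some:
  assumes "inj_on k S" "x \<in> S"
  shows "ranking_sweep E k (k x) S = S - {x} - {y. first_nbr E k S x y}"
  using assms by (auto simp: ranking_sweep_def dest: inj_onD)

lemma first_nbr_unique:
  assumes "inj_on k S" "first_nbr E k S x y" "first_nbr E k S x y'"
  shows "y = y'"
proof (rule inj_onD[OF assms(1)])
  show "k y = k y'" "y \<in> S" "y' \<in> S"
    using assms(2,3) by (auto simp: first_nbr_def intro: antisym)
qed

text \<open>When its turn comes, the surplus vertex \<open>q\<close> takes some \<open>q'\<close>
  that stays free in the other run. The surplus then passes to the run without \<open>q\<close>: the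
  two runs swap roles.\<close>

lemma sweep_insert_self:
  assumes "inj_on k (insert q S)" "q \<notin> S"
  obtains (same) "ranking_sweep E k (k q) S = ranking_sweep E k (k q) (insert q S)"
  | (less) q' where "ranking_sweep E k (k q) S = insert q' (ranking_sweep E k (k q) (insert q S))"
proof -
  have 1: "ranking_sweep E k (k q) S = S"
    using assms by (intro sweep_none) (auto simp: inj_on_def)
  have 2: "ranking_sweep E k (k q) (insert q S) = S - {y. first_nbr E k (insert q S) q y}"
    using sweep_some[OF assms(1), of q] assms(2) by auto
  show thesis
  proof (cases "\<exists>y\<in>S. first_nbr E k (insert q S) q y")
    case True
    then obtain y where y: "y \<in> S" "first_nbr E k (insert q S) q y" by blast
    then have "{y. first_nbr E k (insert q S) q y} = {y}"
      using first_nbr_unique[OF assms(1)] by blast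
    with 1 2 y(1) show thesis by (intro less[of y]) auto
  next
    case False
    with 1 2 show thesis by (intro same) auto
  qed
qed

text \<open>If \<open>x\<close> takes the surplus \<open>q\<close> where it would have taken
  \<open>z\<close>, then \<open>z\<close> becomes the surplus. As \<open>x\<close> preferred
  \<open>q\<close>, the key of the surplus can only grow.\<close>

lemma sweep_insert_later:
  assumes inj: "inj_on k (insert q S)" and q: "q \<notin> S" and t: "t < k q"
  obtains (same) "ranking_sweep E k t (insert q S) = ranking_sweep E k t S"
  | (more) q' where "ranking_sweep E k t (insert q S) = insert q' (ranking_sweep E k t S)" "k q \<le> k q'"
proof (cases "\<exists>x\<in>S. k x = t")
  case False
  then have "ranking_sweep E k t (insert q S) = insert q S" "ranking_sweep E k t S = S"
    using t by (auto intro!: sweep_none)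
  then show thesis using more by blast
next
  case True
  then obtain x where x: "x \<in> S" "k x = t" by blast
  have injS: "inj_on k S" using inj by (rule inj_on_subset) auto
  have xq: "x \<noteq> q" using x q by auto
  have 1: "ranking_sweep E k t S = S - {x} - {y. first_nbr E k S x y}"
    using sweep_some[OF injS x(1)] x by simp
  have 2: "ranking_sweep E k t (insert q S) = insert q S - {x} - {y. first_nbr E k (insert q S) x y}"
    using sweep_some[OF inj, of x] x by simp
  show thesis
  proof (cases "first_nbr E k (insert q S) x q")
    case True
    then have pick: "{y. first_nbr E k (insert q S) x y} = {q}"
      using first_nbr_unique[OF inj] by blast
    show thesis
    proof (cases "\<exists>z. first_nbr E k S x z")
      case True
      then obtain z where z: "first_nbr E k S x z" by blast
      then have pickS: "{y. first_nbr E k S x y} = {z}" and zS: "z \<in> S" "{x, z} \<in> E"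
        using first_nbr_unique[OF injS] by (blast, auto simp: first_nbr_def)
      have "k q \<le> k z" using \<open>first_nbr E k (insert q S) x q\<close> zS by (auto simp: first_nbr_def)
      moreover have "z \<noteq> x" using zS no_loop by auto
      ultimately show thesis
        using 1 2 pick pickS zS q by (intro more[of z]) auto
    next
      case False
      then show thesis using 1 2 pick q by (intro same) auto
    qed
  next
    case False
    have "first_nbr E k (insert q S) x y \<longleftrightarrow> first_nbr E k S x y" for y
    proof
      assume "first_nbr E k (insert q S) x y"
      then show "first_nbr E k S x y" using False by (auto simp: first_nbr_def)
    next
      assume y: "first_nbr E k S x y"
      show "first_nbr E k (insert q S) x y"
      proof (rule ccontr)
        assume "\<not> first_nbr E k (insert q S) x y"
        with y have "{x, q} \<in> E" "k q < k y" by (auto simp: first_nbr_def)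
        with y have "first_nbr E k (insert q S) x q" by (force simp: first_nbr_def)
        with False show False by blast
      qed
    qed
    moreover have "\<not> first_nbr E k S x q" using q by (auto simp: first_nbr_def)
    ultimately show thesis using 1 2 q xq by (intro more[of q]) auto
  qed
qed

text \<open>The surplus starts as \<open>c\<close> and its key never decreases, so it is not
  processed before time \<open>k c\<close>; until then the runs cannot swap roles.\<close>

lemma remaining_insert_later:
  assumes "inj_on k (insert c W)" "c \<notin> W" "t \<le> k c"
  shows "remaining E k W t \<subseteq> remaining E k (insert c W) t"
proof -
  let ?R = "remaining E k W" and ?R' = "remaining E k (insert c W)"
  have "?R' t = ?R t \<or> (\<exists>q. q \<notin> ?R t \<and> k c \<le> k q \<and> ?R' t = insert q (?R t))"
    using assms(3)
  proof (induction t)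
    case (Suc t)
    then consider "?R' t = ?R t" | q where "q \<notin> ?R t" "k c \<le> k q" "?R' t = insert q (?R t)"
      by force
    then show ?case
    proof cases
      case 2
      have "inj_on k (insert q (?R t))"
        using assms(1) remaining_subset[of E k "insert c W" t] 2(3) inj_on_subset by metis
      with 2 Suc.prems have "?R' (Suc t) = ?R (Suc t) \<or> (\<exists>q. k c \<le> k q \<and> ?R' (Suc t) = insert q (?R (Suc t)))"
        using sweep_insert_later[of k q "?R t" t] by (metis (full_types) le_trans Suc_le_eq remaining.simps(2))
      then show ?thesis by (metis insert_absorb)
    qed simp
  qed (use assms(2) in auto)
  then show ?thesis by auto
qed

text \<open>The runs differ along one alternating path, and at any time only in its current end
  \<open>q\<close>. Removing \<open>q\<close> on both sides leaves open which run has the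
  surplus.\<close>

lemma remaining_near:
  assumes "inj_on k (insert c W)" "c \<notin> W"
  shows "\<exists>q. remaining E k W t - {q} = remaining E k (insert c W) t - {q}"
proof -
  let ?R = "remaining E k W" and ?R' = "remaining E k (insert c W)"
  have *: "\<exists>q. ranking_sweep E k t S - {q} = ranking_sweep E k t (insert p S) - {q}"
    if "inj_on k (insert p S)" "p \<notin> S" "\<And>v. v \<in> insert p S \<Longrightarrow> t \<le> k v" for p S t
  proof (cases "k p = t")
    case True
    show ?thesis
    proof (rule sweep_insert_self[OF that(1,2)])
      fix q' assume "ranking_sweep E k (k p) S = insert q' (ranking_sweep E k (k p) (insert p S))"
      with True show ?thesis by (intro exI[of _ q']) auto
    qed (use True in auto)
  next
    case False
    then have "t < k p" using that(3)[of p] by simp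
    show ?thesis
    proof (rule sweep_insert_later[OF that(1,2) \<open>t < k p\<close>])
      fix q' assume "ranking_sweep E k t (insert p S) = insert q' (ranking_sweep E k t S)"
      then show ?thesis by (intro exI[of _ q']) auto
    qed auto
  qed
  have inj: "inj_on k (?R t)" "inj_on k (?R' t)" for t
    using assms(1) remaining_subset[of E k W t] remaining_subset[of E k "insert c W" t]
    by (meson inj_on_subset subset_insertI2)+
  show ?thesis
  proof (induction t)
    case (Suc t)
    then obtain q where q: "?R t - {q} = ?R' t - {q}" by blast
    have keys: "t \<le> k v" if "v \<in> ?R t \<or> v \<in> ?R' t" for v using that remaining_key by metis
    consider "?R t = ?R' t" | "q \<notin> ?R t" "?R' t = insert q (?R t)" | "q \<notin> ?R' t" "?R t = insert q (?R' t)"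
      using q by blast
    then show ?case
    proof cases
      case 2
      then show ?thesis using *[of q "?R t" t] inj(2)[of t] keys by auto
    next
      case 3
      then obtain q' where "ranking_sweep E k t (?R' t) - {q'} = ranking_sweep E k t (?R t) - {q'}"
        using *[of q "?R' t" t] inj(1)[of t] keys by auto
      then show ?thesis by auto
    qed auto
  qed auto
qed

text \<open>A vertex that is still free at time \<open>t\<close> has neither chosen nor been chosen,
  so no choice before \<open>t\<close> noticed it.\<close>

lemma remaining_insert_present:
  assumes "c \<notin> W" "c \<in> remaining E k (insert c W) t"
  shows "remaining E k (insert c W) t = insert c (remaining E k W t)"
  using assms(2)
proof (induction t)
  case (Suc t)
  let ?S = "remaining E k W t"
  have c: "c \<in> remaining E k (insert c W) t" "k c \<noteq> t"
    using Suc.prems by (auto simp: ranking_sweep_def)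
  have IH: "remaining E k (insert c W) t = insert c ?S" using Suc.IH[OF c(1)] .
  have nf: "\<not> first_nbr E k (insert c ?S) x c" if "x \<in> ?S" "k x = t" for x
    using Suc.prems that by (auto simp: ranking_sweep_def IH)
  have "first_nbr E k (insert c ?S) x y \<longleftrightarrow> first_nbr E k ?S x y" if "x \<in> ?S" "k x = t" "y \<noteq> c" for x y
  proof
    assume y: "first_nbr E k ?S x y"
    show "first_nbr E k (insert c ?S) x y"
    proof (rule ccontr)
      assume "\<not> first_nbr E k (insert c ?S) x y"
      with y have "{x, c} \<in> E" "k c < k y" by (auto simp: first_nbr_def)
      with y have "first_nbr E k (insert c ?S) x c" by (force simp: first_nbr_def)
      with nf that show False by blast
    qed
  qed (use that in \<open>auto simp: first_nbr_def\<close>)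
  moreover have "c \<notin> ?S" using assms(1) subsetD[OF remaining_subset[of E k W t], of c] by blast
  ultimately have "v \<in> ranking_sweep E k t (insert c ?S) \<longleftrightarrow> v \<in> insert c (ranking_sweep E k t ?S)" for v
    using c(2) nf by (cases "v = c") (auto simp: ranking_sweep_def)
  then show ?case unfolding remaining.simps IH by blast
qed simp

section \<open>Rank gaps around a pair of adjacent vertices\<close>

text \<open>At time \<open>k c\<close> the run without \<open>d\<close> is the same for both keys
  and still offers \<open>u\<close> to \<open>c\<close>, so \<open>c\<close> stays matched. If
  \<open>d\<close> is free when its new turn comes, it was already a candidate of \<open>c\<close>,
  and it now beats \<open>u\<close>.\<close>

lemma matched_of_move_into_gap:
  assumes inj: "inj_on k V" "inj_on k' V" and V: "c \<in> V" "d \<in> V" and cd: "{c, d} \<in> E"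
    and cu: "chooses E k V c u" and d: "\<not> matched E k V d"
    and k': "\<And>v. v \<in> V \<Longrightarrow> v \<noteq> d \<Longrightarrow> k' v = k v" and gap: "k c < k' d" "k' d < k u"
  shows "matched E k' V c \<and> matched E k' V d"
proof -
  let ?W = "V - {d}"
  have Vd: "insert d ?W = V" using V(2) by blast
  have neq: "c \<noteq> d" using cd no_loop by auto
  \<comment> \<open>Otherwise \<open>d\<close> would be processed while its neighbour
    \<open>c\<close> is free, and would be matched.\<close>
  have "k c < k d"
  proof (rule ccontr)
    assume "\<not> k c < k d"
    moreover have "c \<in> remaining E k V (k c)" using chooses_remaining[OF cu] by simp
    ultimately have "c \<in> remaining E k V (k d)"
      using remaining_antimono[of "k d" "k c" E k V] by auto
    with d V(2) cd show False using matched_of_remaining_nbr[of d V c k] by (simp add: insert_commute)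
  qed
  then have "d \<in> remaining E k V (k c)" using unmatched_remaining[OF V(2) d] by simp
  then have "remaining E k V (k c) = insert d (remaining E k ?W (k c))"
    using remaining_insert_present[of d ?W k "k c"] by (simp only: Vd) simp
  moreover have "remaining E k ?W (k c) = remaining E k' ?W (k c)"
    using k' by (intro remaining_cong) auto
  ultimately have eq: "remaining E k V (k c) = insert d (remaining E k' ?W (k c))" by simp
  have "u \<noteq> d" using d cu by (auto simp: matched_def)
  then have cu': "c \<in> remaining E k' ?W (k c)" "u \<in> remaining E k' ?W (k c)" "{c, u} \<in> E" "u \<in> V"
    using chooses_remaining[OF cu] neq unfolding eq by auto
  have k'c: "k' c = k c" using k' V(1) neq by simp
  have sub: "remaining E k' ?W (k c) \<subseteq> remaining E k' V (k c)"
    using remaining_insert_later[of k' d ?W "k c"] inj(2) gap(1) unfolding Vd by simp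
  have c: "matched E k' V c"
    using matched_of_remaining_nbr[OF V(1), of u k'] cu' sub k'c by auto
  have "matched E k' V d"
  proof (cases "d \<in> remaining E k' V (k' d)")
    case True
    then have "d \<in> remaining E k' V (k c)"
      using remaining_antimono[of "k c" "k' d" E k' V] gap(1) by auto
    then have eq': "remaining E k' V (k c) = insert d (remaining E k' ?W (k c))"
      using remaining_insert_present[of d ?W k' "k c"] by (simp only: Vd) simp
    then obtain y where y: "chooses E k' V c y"
      using active_chooses[of c k' V d] cu' cd k'c by auto
    \<comment> \<open>Apart from \<open>d\<close>, the candidates of \<open>c\<close> are the old
      ones, of which \<open>u\<close> was the best.\<close>
    have "y = d"
    proof (rule ccontr)
      assume "y \<noteq> d"
      then have "y \<in> remaining E k' ?W (k c)"
        using chooses_remaining[OF y] unfolding k'c eq' by simp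
      then have "y \<in> remaining E k V (k c)" unfolding eq by simp
      then have "k u \<le> k y" using cu chooses_remaining(3)[OF y] by (auto simp: chooses_def first_nbr_def)
      moreover have "k' y \<le> k' d"
        using y cd unfolding chooses_def first_nbr_def k'c eq' by simp
      moreover have "k' y = k y" using k' \<open>y \<noteq> d\<close> chooses_remaining[OF y] by simp
      ultimately show False using gap(2) by simp
    qed
    then show ?thesis using y by (auto simp: matched_def)
  qed (use passive_matched V(2) in blast)
  with c show ?thesis ..
qed

text \<open>Adding \<open>c\<close> destroys at most one of the two free neighbours, and adding
  \<open>d\<close> changes nothing as long as \<open>d\<close> itself is free.\<close>

lemma matched_of_two_nbrs:
  assumes inj: "inj_on k V" and V: "c \<in> V" "d \<in> V" "c \<noteq> d"
    and z: "z1 \<in> remaining E k (V - {c, d}) (k d)" "z2 \<in> remaining E k (V - {c, d}) (k d)"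
      "{d, z1} \<in> E" "{d, z2} \<in> E" "z1 \<noteq> z2"
  shows "matched E k V d"
proof (cases "d \<in> remaining E k V (k d)")
  case True
  have V': "insert d (V - {d}) = V" "insert c (V - {c, d}) = V - {d}" using V by auto
  have 1: "remaining E k V (k d) = insert d (remaining E k (V - {d}) (k d))"
    using remaining_insert_present[of d "V - {d}" k "k d"] True by (simp only: V') simp
  have "inj_on k (V - {d})" using inj by (rule inj_on_subset) auto
  then obtain q where
    "remaining E k (V - {c, d}) (k d) - {q} = remaining E k (V - {d}) (k d) - {q}"
    using remaining_near[of k c "V - {c, d}" "k d"] unfolding V' by auto
  then have "z1 \<in> remaining E k (V - {d}) (k d) \<or> z2 \<in> remaining E k (V - {d}) (k d)"
    using z(1,2,5) by blast
  then show ?thesis using matched_of_remaining_nbr[OF V(2), of _ k] z(3,4) unfolding 1 by blast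
qed (use passive_matched V(2) in blast)

text \<open>The pair is \<open>{c, d}\<close> with \<open>d\<close> first. Apart from the case that both are matched, an edge
  is exhibited whose rank gap is controlled by the run without \<open>c\<close> and \<open>d\<close>.\<close>

lemma matched_pair_cases:
  assumes inj: "inj_on k V" and V: "c \<in> V" "d \<in> V" and cd: "{c, d} \<in> E" and less: "k d < k c"
  obtains "matched E k V c" "matched E k V d"
  | x where "chooses E k V x c" "k x < k d"
  | x where "chooses E k V x d" "x \<in> remaining E k (V - {c, d}) (k x)" "{d, x} \<in> E" "k x < k d"
  | z where "chooses E k V d z" "z \<in> remaining E k (V - {c, d}) (k d)" "{d, z} \<in> E" "k z < k c"
proof -
  have V': "insert d (V - {d}) = V" "insert c (V - {c, d}) = V - {d}" using V less by auto
  \<comment> \<open>As long as both are free, neither has influenced the run.\<close>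
  have present: "remaining E k V t = insert d (insert c (remaining E k (V - {c, d}) t))"
    if "d \<in> remaining E k V t" "c \<in> remaining E k V t" for t
  proof -
    have 1: "remaining E k V t = insert d (remaining E k (V - {d}) t)"
      using remaining_insert_present[of d "V - {d}" k t] that by (simp only: V') simp
    then have "c \<in> remaining E k (V - {d}) t" using that less by auto
    then have "remaining E k (V - {d}) t = insert c (remaining E k (V - {c, d}) t)"
      using remaining_insert_present[of c "V - {c, d}" k t] by (simp only: V') simp
    with 1 show ?thesis by simp
  qed
  show thesis
  proof (cases "c \<in> remaining E k V (k d)")
    case False
    then show thesis using remaining_exit[OF V(1) False] less that(2) by auto
  next
    case c: True
    show thesis
    proof (cases "d \<in> remaining E k V (k d)")
      case False
      then obtain x where x: "chooses E k V x d" "k x < k d" using remaining_exit[OF V(2) False] by auto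
      note xr = chooses_remaining[OF x(1)]
      have "c \<in> remaining E k V (k x)" using c x(2) remaining_antimono[of "k x" "k d" E k V] by auto
      then have "x \<in> remaining E k (V - {c, d}) (k x)"
        using xr x(2) less present[of "k x"] by auto
      then show thesis using that(3) x xr by (simp add: insert_commute)
    next
      case True
      then obtain z where z: "chooses E k V d z"
        using active_chooses[OF True c] cd by (auto simp: insert_commute)
      show thesis
      proof (cases "z = c")
        case True
        then show thesis using that(1) z by (auto simp: matched_def)
      next
        case False
        have "k z \<le> k c" using z c cd by (auto simp: chooses_def first_nbr_def insert_commute)
        moreover have "k z \<noteq> k c" using False inj V chooses_remaining[OF z] by (auto dest: inj_onD)
        ultimately show thesis
          using that(4)[OF z] chooses_remaining[OF z] present[OF True c] False by auto
      qed
    qed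
  qed
qed

end

section \<open>Integer ranks, charges and free neighbours of a pair\<close>

locale ranked_graph = loopless E for E :: "'a set set" +
  fixes V :: "'a set" and n :: nat and idx :: "'a \<Rightarrow> nat"
  assumes finite_V: "finite V" and inj_idx: "inj_on idx V" and idx_less: "v \<in> V \<Longrightarrow> idx v < n"
begin

text \<open>Ranks are drawn from a finite grid, so that single ranks can be resampled independently;
  \<open>idx\<close> breaks ties.\<close>

definition key :: "('a \<Rightarrow> nat) \<Rightarrow> 'a \<Rightarrow> nat" where
  "key r v = r v * n + idx v"

lemma key_less: "v \<in> V \<Longrightarrow> r v < r w \<Longrightarrow> key r v < key r w"
proof -
  assume "v \<in> V" "r v < r w"
  then have "key r v < Suc (r v) * n" using idx_less by (simp add: key_def)
  also have "\<dots> \<le> r w * n" using \<open>r v < r w\<close> by (intro mult_le_mono1) simp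
  finally show ?thesis by (simp add: key_def)
qed

lemma key_less_imp: "w \<in> V \<Longrightarrow> key r v < key r w \<Longrightarrow> r v \<le> r w"
  using key_less[of w r v] by fastforce

lemma inj_key: "inj_on (key r) V"
proof (rule inj_onI)
  fix v w assume vw: "v \<in> V" "w \<in> V" "key r v = key r w"
  then have "r v = r w" using key_less[of v r w] key_less[of w r v] by (metis nat_neq_iff)
  with vw show "v = w" using inj_idx by (auto simp: key_def dest: inj_onD)
qed

abbreviation "ch r \<equiv> chooses E (key r) V"
abbreviation "mt r \<equiv> matched E (key r) V"

lemma ch_le: "ch r x y \<Longrightarrow> r x \<le> r y"
  using chooses_less[OF inj_key, of r x y] chooses_remaining(5)[of "key r" V x y] key_less_imp[of y r x] by blast

definition gap_sum :: "('a \<Rightarrow> nat) \<Rightarrow> 'a \<Rightarrow> real" where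
  "gap_sum r c = (\<Sum>y\<in>{y\<in>V. ch r c y}. real (r y) - real (r c))"

definition passive_gap_sum :: "('a \<Rightarrow> nat) \<Rightarrow> 'a \<Rightarrow> real" where
  "passive_gap_sum r c = (\<Sum>x\<in>{x\<in>V. ch r x c}. real (r c) - real (r x))"

text \<open>\<open>charge r c d\<close> is the rank gap of the matched edge at \<open>c\<close>, counted only if the partner \<open>d\<close> of \<open>c\<close>
  stays unmatched.\<close>

definition charge :: "('a \<Rightarrow> nat) \<Rightarrow> 'a \<Rightarrow> 'a \<Rightarrow> real" where
  "charge r c d = of_bool (\<not> mt r d) * (gap_sum r c + passive_gap_sum r c)"

lemma gap_sum_nonneg: "0 \<le> gap_sum r c"
  unfolding gap_sum_def using ch_le by (intro sum_nonneg) auto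

lemma passive_gap_sum_nonneg: "0 \<le> passive_gap_sum r c"
  unfolding passive_gap_sum_def using ch_le by (intro sum_nonneg) auto

lemma charge_nonneg: "0 \<le> charge r c d"
  by (simp add: charge_def gap_sum_nonneg passive_gap_sum_nonneg)

lemma charge_ge:
  assumes "ch r x y" "c = x \<or> c = y" "\<not> mt r d"
  shows "real (r y) - real (r x) \<le> charge r c d"
proof -
  have xy: "x \<in> V" "y \<in> V" using chooses_remaining[OF assms(1)] by auto
  have "c = x \<Longrightarrow> real (r y) - real (r x) \<le> gap_sum r c"
    unfolding gap_sum_def using xy assms(1) ch_le finite_V
    by (intro member_le_sum[of y _ "\<lambda>y. real (r y) - real (r c)", THEN order_trans[rotated]]) auto
  moreover have "c = y \<Longrightarrow> real (r y) - real (r x) \<le> passive_gap_sum r c"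
    unfolding passive_gap_sum_def using xy assms(1) ch_le finite_V
    by (intro member_le_sum[of x _ "\<lambda>x. real (r c) - real (r x)", THEN order_trans[rotated]]) auto
  ultimately show ?thesis
    using assms(2,3) gap_sum_nonneg[of r c] passive_gap_sum_nonneg[of r c] by (auto simp: charge_def)
qed

text \<open>Leaving out both \<open>c\<close> and \<open>d\<close> makes this set independent of
  their ranks, which can then be resampled together. Below, the time \<open>s * n + idx d\<close> is
  the key of \<open>d\<close> at rank \<open>s\<close>.\<close>

definition free_nbrs :: "('a \<Rightarrow> nat) \<Rightarrow> 'a \<Rightarrow> 'a \<Rightarrow> nat \<Rightarrow> 'a set" where
  "free_nbrs r c d t = {z\<in>remaining E (key r) (V - {c, d}) t. {d, z} \<in> E}"

lemma free_nbrs_antimono: "t \<le> t' \<Longrightarrow> free_nbrs r c d t' \<subseteq> free_nbrs r c d t"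
  using remaining_antimono[of t t' E "key r" "V - {c, d}"] by (auto simp: free_nbrs_def)

lemma finite_free_nbrs: "finite (free_nbrs r c d t)"
  using finite_subset[OF remaining_subset, of "V - {c, d}" E "key r" t] finite_V
  by (auto simp: free_nbrs_def)

lemma free_nbrs_cong:
  assumes "\<And>v. v \<in> V - {c, d} \<Longrightarrow> r v = r' v"
  shows "free_nbrs r c d t = free_nbrs r' c d t"
  using remaining_cong[of "V - {c, d}" "key r" "key r'" E t] assms by (simp add: free_nbrs_def key_def)

text \<open>The gap is read off from the case in \<open>matched_pair_cases\<close>. If
  \<open>c\<close> is taken before \<open>d\<close>'s turn, it is at least \<open>r c - r d\<close>.
  If \<open>d\<close> is taken by \<open>x\<close>, then \<open>x\<close> is a free neighbour of
  \<open>d\<close> until its own turn, so it comes no later than \<tau>, and no later than \<sigma>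
  if a second free neighbour outlives it. If \<open>d\<close> chooses \<open>z\<close>, then
  \<open>z\<close> is its last free neighbour and lasts to \<tau>, up to the rounding error
  1.\<close>

lemma charge_region:
  fixes N :: nat
  assumes V: "c \<in> V" "d \<in> V" and cd: "{c, d} \<in> E" and N: "r d < r c" "r c < N"
    and two: "\<And>s. s < N \<Longrightarrow> 2 \<le> card (free_nbrs r c d (s * n + idx d)) \<longleftrightarrow> s < \<sigma>"
    and one: "\<And>s. s < N \<Longrightarrow> free_nbrs r c d (s * n + idx d) \<noteq> {} \<longleftrightarrow> s < \<tau>"
    and \<sigma>: "\<sigma> \<le> r d" "\<tau> \<le> N"
  defines "m \<equiv> (if \<tau> \<le> r d then min (real (r d) - \<tau>) (real (r c) - r d)
                else min (real (r d) - \<sigma>) (min (real (r c)) \<tau> - r d))"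
  assumes unm: "\<not> (mt r c \<and> mt r d)"
  shows "m - 1 \<le> charge r c d + charge r d c"
proof -
  \<comment> \<open>Passes from times to ranks; only the last rank before \<open>r x\<close> is
    needed.\<close>
  have before: "r x \<le> s" if x: "x \<in> V" "r x < N" "\<And>s'. s' < r x \<Longrightarrow> s' * n + idx d \<le> key r x \<Longrightarrow> s' < s" for x s
  proof (cases "r x")
    case (Suc s')
    have "s' * n + idx d \<le> Suc s' * n" using idx_less[OF V(2)] by simp
    also have "\<dots> \<le> key r x" by (simp add: key_def Suc)
    finally show ?thesis using x(3)[of s'] Suc by simp
  qed simp
  have kd: "key r d = r d * n + idx d" by (simp add: key_def)
  have less: "key r d < key r c" using key_less V N by simp
  from inj_key V cd less show ?thesis
  proof (cases rule: matched_pair_cases)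
    case 1
    with unm show ?thesis by simp
  next
    case (2 x)
    then have d: "\<not> mt r d" using unm by (auto simp: matched_def)
    have "r x \<le> r d" using 2 key_less_imp V by auto
    moreover have "m \<le> real (r c) - r d" by (auto simp: m_def)
    moreover have "real (r c) - r x \<le> charge r c d" using charge_ge[OF 2(1) _ d] by simp
    ultimately show ?thesis using charge_nonneg[of r d c] by simp
  next
    case (3 x)
    then have c: "\<not> mt r c" using unm by (auto simp: matched_def)
    have x: "x \<in> V" "r x \<le> r d" using 3 key_less_imp V chooses_remaining[OF 3(1)] by auto
    have gap: "real (r d) - r x \<le> charge r d c" using charge_ge[OF 3(1) _ c] by simp
    have xn: "x \<in> free_nbrs r c d (key r x)" using 3 by (simp add: free_nbrs_def)
    show ?thesis
    proof (cases "\<tau> \<le> r d")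
      case True
      have "r x \<le> \<tau>"
      proof (rule before)
        fix s' assume "s' < r x" "s' * n + idx d \<le> key r x"
        then have "x \<in> free_nbrs r c d (s' * n + idx d)" using xn free_nbrs_antimono by blast
        then show "s' < \<tau>" using one[of s'] \<open>s' < r x\<close> x N by auto
      qed (use x N in auto)
      then show ?thesis using True gap charge_nonneg[of r c d] by (simp add: m_def)
    next
      case False
      \<comment> \<open>This \<open>z\<close> is still free at the turn of \<open>d\<close>, whereas
        \<open>x\<close> was processed earlier: two distinct free neighbours at the time of
        \<open>x\<close>.\<close>
      then obtain z where z: "z \<in> free_nbrs r c d (key r d)" using one[of "r d"] N kd by auto
      then have "key r d \<le> key r z" using remaining_key by (fastforce simp: free_nbrs_def)
      then have "z \<noteq> x" using 3 by auto
      have "r x \<le> \<sigma>"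
      proof (rule before)
        fix s' assume s': "s' < r x" "s' * n + idx d \<le> key r x"
        then have "{x, z} \<subseteq> free_nbrs r c d (s' * n + idx d)"
          using xn z free_nbrs_antimono[of "s' * n + idx d" "key r d" r c d] 3(4)
            free_nbrs_antimono[of "s' * n + idx d" "key r x" r c d] by auto
        from card_mono[OF finite_free_nbrs this] \<open>z \<noteq> x\<close>
        show "s' < \<sigma>" using two[of s'] \<open>s' < r x\<close> x N by auto
      qed (use x N in auto)
      then show ?thesis using False gap charge_nonneg[of r c d] by (simp add: m_def)
    qed
  next
    case (4 z)
    then have c: "\<not> mt r c" using unm by (auto simp: matched_def)
    have z: "z \<in> V" "r z \<le> r c" using 4 key_less_imp V chooses_remaining[OF 4(1)] by auto
    have gap: "real (r z) - r d \<le> charge r d c" using charge_ge[OF 4(1) _ c] by simp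
    have zn: "z \<in> free_nbrs r c d (key r d)" using 4 by (simp add: free_nbrs_def)
    then have \<tau>: "r d < \<tau>" using one[of "r d"] N kd by auto
    \<comment> \<open>\<open>\<tau> - 1\<close> is the last rank with a free neighbour. Since
      \<sigma> is at most \<open>r d\<close>, only one is left at the turn of \<open>d\<close>, so
      \<open>w\<close> must be the chosen \<open>z\<close>.\<close>
    then obtain w where w: "w \<in> free_nbrs r c d ((\<tau> - 1) * n + idx d)"
      using one[of "\<tau> - 1"] \<sigma> N by fastforce
    have "key r d \<le> (\<tau> - 1) * n + idx d" unfolding kd using \<tau> by (intro add_right_mono mult_le_mono1) auto
    then have "{w, z} \<subseteq> free_nbrs r c d (key r d)" using w zn free_nbrs_antimono by blast
    then have "card {w, z} \<le> card (free_nbrs r c d (key r d))"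
      by (rule card_mono[OF finite_free_nbrs])
    then have "w = z"
      using two[of "r d"] \<sigma> N kd by (cases "w = z") auto
    then have le: "(\<tau> - 1) * n + idx d \<le> key r z"
      using w remaining_key by (fastforce simp: free_nbrs_def)
    have "\<tau> - 1 \<le> r z"
    proof (rule ccontr)
      assume "\<not> \<tau> - 1 \<le> r z"
      then have "Suc (r z) * n \<le> (\<tau> - 1) * n" by (intro mult_le_mono1) auto
      moreover have "key r z < Suc (r z) * n" using idx_less[OF z(1)] by (simp add: key_def)
      ultimately show False using le by simp
    qed
    then show ?thesis using \<tau> z gap charge_nonneg[of r c d] by (simp add: m_def)
  qed
qed

lemma matched_of_two_free_nbrs:
  assumes "c \<in> V" "d \<in> V" "{c, d} \<in> E"
    and "2 \<le> card (free_nbrs r c d (r d * n + idx d))"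
  shows "mt r d"
proof -
  have "\<not> card (free_nbrs r c d (key r d)) \<le> Suc 0" using assms(4) by (simp add: key_def)
  then obtain z1 z2 where
    "z1 \<in> free_nbrs r c d (key r d)" "z2 \<in> free_nbrs r c d (key r d)" "z1 \<noteq> z2"
    unfolding card_le_Suc0_iff_eq[OF finite_free_nbrs] by blast
  moreover have "c \<noteq> d" using assms(3) no_loop by auto
  ultimately show ?thesis
    using matched_of_two_nbrs[OF inj_key[of r] assms(1,2), of z1 z2] by (simp add: free_nbrs_def key_def)
qed

end

section \<open>Optimising over the thresholds\<close>

lemma antimono_threshold:
  fixes P :: "nat \<Rightarrow> bool"
  assumes "\<And>s t. s \<le> t \<Longrightarrow> P t \<Longrightarrow> P s"
  obtains m where "m \<le> N" "\<And>s. s < N \<Longrightarrow> P s \<longleftrightarrow> s < m"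
proof (cases "\<exists>s<N. \<not> P s")
  case True
  define m where "m = (LEAST s. \<not> P s)"
  have "\<not> P m" using True unfolding m_def by (metis LeastI)
  moreover have "P s" if "s < m" for s using that not_less_Least unfolding m_def by blast
  moreover have "m \<le> N" using True Least_le[of "\<lambda>s. \<not> P s"] unfolding m_def by (meson le_trans less_imp_le)
  ultimately show thesis using that[of m] assms[of m] by (meson not_le)
qed (use that[of N] in auto)

text \<open>A discrete tent of area \<open>b^2 / 4\<close>. Going from \<open>b\<close> to
  \<open>b + 2\<close> shifts the terms and raises each by one, hence the two-step
  induction.\<close>

lemma sum_min_ge: "(\<Sum>j<b. min (real j) (real b - real j)) \<ge> (real b ^ 2 - 1) / 4"
proof (induction b rule: induct_nat_012)
  case (ge2 b)
  have "(\<Sum>j<Suc (Suc b). min (real j) (real (Suc (Suc b)) - real j)) =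
      (\<Sum>j<Suc b. min (real (Suc j)) (real (Suc (Suc b)) - real (Suc j)))"
    by (subst sum.lessThan_Suc_shift) simp
  also have "\<dots> = (\<Sum>j<Suc b. min (real j) (real b - real j) + 1)"
    by (intro sum.cong) auto
  also have "\<dots> = (\<Sum>j<b. min (real j) (real b - real j)) + real b + 1"
    by (simp add: sum.distrib)
  finally show ?case using ge2.IH(1) by (simp add: power2_eq_square algebra_simps)
qed (auto simp: power2_eq_square)

lemma sum_squares_ge: "(\<Sum>b<L. real b ^ 2) \<ge> real L ^ 3 / 3 - real L ^ 2"
  by (induction L) (auto simp: power2_eq_square power3_eq_cube algebra_simps)

text \<open>\<open>margin\<close> is the gap forced by a pair with ranks \<open>s < a\<close> when, in the run without the pair,
  the vertex of rank \<open>s\<close> has at least two, respectively at least one, free neighbours exactly up to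
  rank \<open>\<sigma>\<close>, respectively \<open>\<tau>\<close>.\<close>

definition margin :: "nat \<Rightarrow> nat \<Rightarrow> nat \<Rightarrow> nat \<Rightarrow> real" where
  "margin \<sigma> \<tau> s a = (if \<tau> \<le> s then min (real s - \<tau>) (real a - s)
                     else min (real s - \<sigma>) (min (real a) \<tau> - s))"

lemma margin_le: "s \<le> a \<Longrightarrow> a \<le> N \<Longrightarrow> margin \<sigma> \<tau> s a \<le> real N / 2"
  by (auto simp: margin_def min_def)

lemma sum_shifted_min_ge:
  assumes "\<sigma> \<le> b"
  shows "(\<Sum>s\<in>{\<sigma>..<b}. min (real s - \<sigma>) (real b - s)) \<ge> ((real b - \<sigma>) ^ 2 - 1) / 4"
proof -
  have "(\<Sum>s\<in>{\<sigma>..<b}. min (real s - \<sigma>) (real b - s)) = (\<Sum>j<b - \<sigma>. min (real j) (real (b - \<sigma>) - real j))"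
    by (rule sum.reindex_bij_witness[of _ "\<lambda>j. j + \<sigma>" "\<lambda>s. s - \<sigma>"]) (use assms in auto)
  with sum_min_ge[of "b - \<sigma>"] assms show ?thesis by (simp add: of_nat_diff)
qed

lemma sum_shifted_squares_ge:
  assumes "\<tau> \<le> b"
  shows "(\<Sum>s\<in>{\<tau>..<b}. (real s - \<tau>) ^ 2) \<ge> (real b - \<tau>) ^ 3 / 3 - (real b - \<tau>) ^ 2"
proof -
  have "(\<Sum>s\<in>{\<tau>..<b}. (real s - \<tau>) ^ 2) = (\<Sum>j<b - \<tau>. real j ^ 2)"
    by (rule sum.reindex_bij_witness[of _ "\<lambda>j. j + \<tau>" "\<lambda>s. s - \<tau>"]) (use assms in auto)
  with sum_squares_ge[of "b - \<tau>"] assms show ?thesis by (simp add: of_nat_diff)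
qed

text \<open>For a fixed sum \<open>x + y\<close> the minimum is at \<open>y = 2 * x\<close>, where
  the ratio is 15/27; the difference therefore contains the factor
  \<open>(2 * x - y)^2\<close>.\<close>

lemma cubic_bound:
  fixes x y :: real
  assumes "0 \<le> x" "0 \<le> y"
  shows "y ^ 3 + 3 * y * x ^ 2 + x ^ 3 \<ge> 5 / 9 * (x + y) ^ 3"
proof -
  have "y ^ 3 + 3 * y * x ^ 2 + x ^ 3 - 5 / 9 * (x + y) ^ 3 = 1 / 9 * ((2 * x - y) ^ 2 * (x + 4 * y))"
    by (simp add: power2_eq_square power3_eq_cube field_simps)
  moreover have "0 \<le> (2 * x - y) ^ 2 * (x + 4 * y)" using assms by simp
  ultimately show ?thesis by linarith
qed

text \<open>For fixed \<open>a\<close> the margin is a tent over \<open>[\<sigma>, a)\<close>, or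
  two tents over \<open>[\<sigma>, \<tau>)\<close> and \<open>[\<tau>, a)\<close> once
  \<open>a\<close> reaches \<tau>. With \<open>x = \<tau> - \<sigma>\<close> and
  \<open>y = N - \<tau>\<close> the volume is \<open>(x^3 + 3 * y * x^2 + y^3) / 12\<close>, and
  \<open>cubic_bound\<close> turns 5/9 into 5/108.\<close>

lemma sum_margin_ge:
  assumes "\<sigma> \<le> \<tau>" "\<tau> \<le> N"
  shows "(\<Sum>a<N. \<Sum>s<N. of_bool (s < a \<and> \<sigma> \<le> s) * margin \<sigma> \<tau> s a)
    \<ge> 5 / 108 * (real N - \<sigma>) ^ 3 - real N ^ 2"
proof -
  have row: "(\<Sum>s<N. of_bool (s < a \<and> \<sigma> \<le> s) * margin \<sigma> \<tau> s a) = (\<Sum>s\<in>{\<sigma>..<a}. margin \<sigma> \<tau> s a)"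
    if "a < N" for a
  proof -
    have "(\<Sum>s<N. of_bool (s < a \<and> \<sigma> \<le> s) * margin \<sigma> \<tau> s a) =
        (\<Sum>s<N. if s \<in> {\<sigma>..<a} then margin \<sigma> \<tau> s a else 0)"
      by (intro sum.cong) auto
    also have "\<dots> = (\<Sum>s\<in>{..<N} \<inter> {\<sigma>..<a}. margin \<sigma> \<tau> s a)"
      by (simp add: sum.inter_restrict)
    also have "{..<N} \<inter> {\<sigma>..<a} = {\<sigma>..<a}" using that by auto
    finally show ?thesis .
  qed
  have low: "(\<Sum>s\<in>{\<sigma>..<a}. margin \<sigma> \<tau> s a) \<ge> ((real a - \<sigma>) ^ 2 - 1) / 4" if "\<sigma> \<le> a" "a < \<tau>" for a
  proof -
    have "(\<Sum>s\<in>{\<sigma>..<a}. margin \<sigma> \<tau> s a) = (\<Sum>s\<in>{\<sigma>..<a}. min (real s - \<sigma>) (real a - s))"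
      using that by (intro sum.cong) (auto simp: margin_def)
    with sum_shifted_min_ge[OF that(1)] show ?thesis by simp
  qed
  have high: "(\<Sum>s\<in>{\<sigma>..<a}. margin \<sigma> \<tau> s a) \<ge> ((real a - \<tau>) ^ 2 - 1) / 4 + ((real \<tau> - \<sigma>) ^ 2 - 1) / 4"
    if "\<tau> \<le> a" for a
  proof -
    have "(\<Sum>s\<in>{\<sigma>..<a}. margin \<sigma> \<tau> s a) =
        (\<Sum>s\<in>{\<sigma>..<\<tau>}. margin \<sigma> \<tau> s a) + (\<Sum>s\<in>{\<tau>..<a}. margin \<sigma> \<tau> s a)"
      using that assms by (simp add: sum.atLeastLessThan_concat)
    also have "(\<Sum>s\<in>{\<sigma>..<\<tau>}. margin \<sigma> \<tau> s a) = (\<Sum>s\<in>{\<sigma>..<\<tau>}. min (real s - \<sigma>) (real \<tau> - s))"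
      using that by (intro sum.cong) (auto simp: margin_def)
    also have "(\<Sum>s\<in>{\<tau>..<a}. margin \<sigma> \<tau> s a) = (\<Sum>s\<in>{\<tau>..<a}. min (real s - \<tau>) (real a - s))"
      by (intro sum.cong) (auto simp: margin_def)
    finally show ?thesis using sum_shifted_min_ge[OF that(1)] sum_shifted_min_ge[OF assms(1)] by linarith
  qed
  let ?G = "\<lambda>a. \<Sum>s<N. of_bool (s < a \<and> \<sigma> \<le> s) * margin \<sigma> \<tau> s a"
  let ?x = "real \<tau> - \<sigma>" and ?y = "real N - \<tau>"
  have xy: "0 \<le> ?x" "0 \<le> ?y" "?x + ?y \<le> N" using assms by auto
  have A: "(\<Sum>a\<in>{\<sigma>..<\<tau>}. ?G a) \<ge> (?x ^ 3 / 3 - ?x ^ 2) / 4 - ?x / 4"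
  proof -
    have "(\<Sum>a\<in>{\<sigma>..<\<tau>}. ?G a) \<ge> (\<Sum>a\<in>{\<sigma>..<\<tau>}. ((real a - \<sigma>) ^ 2 - 1) / 4)"
      using row low assms by (intro sum_mono) auto
    also have "(\<Sum>a\<in>{\<sigma>..<\<tau>}. ((real a - \<sigma>) ^ 2 - 1) / 4) = (\<Sum>a\<in>{\<sigma>..<\<tau>}. (real a - \<sigma>) ^ 2) / 4 - ?x / 4"
      using assms by (simp add: sum_divide_distrib[symmetric] sum_subtractf diff_divide_distrib)
    finally show ?thesis using sum_shifted_squares_ge[OF assms(1)] by (simp add: field_simps)
  qed
  have B: "(\<Sum>a\<in>{\<tau>..<N}. ?G a) \<ge> (?y ^ 3 / 3 - ?y ^ 2) / 4 + ?y * ?x ^ 2 / 4 - ?y / 2"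
  proof -
    have "(\<Sum>a\<in>{\<tau>..<N}. ?G a) \<ge> (\<Sum>a\<in>{\<tau>..<N}. (real a - \<tau>) ^ 2 / 4 + (?x ^ 2 - 2) / 4)"
    proof (rule sum_mono)
      fix a assume "a \<in> {\<tau>..<N}"
      then show "(real a - \<tau>) ^ 2 / 4 + (?x ^ 2 - 2) / 4 \<le> ?G a"
        using row[of a] high[of a] by (simp add: field_simps)
    qed
    also have "(\<Sum>a\<in>{\<tau>..<N}. (real a - \<tau>) ^ 2 / 4 + (?x ^ 2 - 2) / 4) =
        (\<Sum>a\<in>{\<tau>..<N}. (real a - \<tau>) ^ 2) / 4 + ?y * ((?x ^ 2 - 2) / 4)"
      using assms by (simp add: sum.distrib sum_divide_distrib[symmetric])
    finally show ?thesis using sum_shifted_squares_ge[OF assms(2)] by (simp add: field_simps)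
  qed
  have "(\<Sum>a<N. ?G a) = (\<Sum>a\<in>{0..<\<sigma>}. ?G a) + (\<Sum>a\<in>{\<sigma>..<\<tau>}. ?G a) + (\<Sum>a\<in>{\<tau>..<N}. ?G a)"
    using assms by (simp add: sum.atLeastLessThan_concat lessThan_atLeast0)
  moreover have "(\<Sum>a\<in>{0..<\<sigma>}. ?G a) = 0"
    by (intro sum.neutral ballI) auto
  ultimately have "(\<Sum>a<N. ?G a) \<ge> (?y ^ 3 + 3 * ?y * ?x ^ 2 + ?x ^ 3) / 12 - (?x ^ 2 + ?y ^ 2 + ?x + 2 * ?y) / 4"
    using A B by (simp add: field_simps)
  moreover have "?x ^ 2 + ?y ^ 2 + ?x + 2 * ?y \<le> 4 * real N ^ 2"
  proof -
    have "u ^ 2 + v ^ 2 \<le> (u + v) ^ 2" if "0 \<le> u" "0 \<le> v" for u v :: real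
      using that by (simp add: power2_sum)
    from this[OF xy(1,2)] have "?x ^ 2 + ?y ^ 2 \<le> (?x + ?y) ^ 2" .
    also have "\<dots> \<le> real N ^ 2" using xy by (intro power_mono) auto
    finally have "?x ^ 2 + ?y ^ 2 \<le> real N ^ 2" .
    moreover have "real N \<le> real N ^ 2" by (cases N) (auto simp: power2_eq_square)
    ultimately show ?thesis
      using of_nat_0_le_iff[of \<sigma>, where 'a = real] of_nat_0_le_iff[of \<tau>, where 'a = real]
        of_nat_0_le_iff[of N, where 'a = real] by argo
  qed
  moreover have "?y ^ 3 + 3 * ?y * ?x ^ 2 + ?x ^ 3 \<ge> 5 / 9 * (real N - \<sigma>) ^ 3"
    using cubic_bound[OF xy(1,2)] by simp
  moreover have "5 / 108 * u - v \<le> w" if "p / 12 - q / 4 \<le> w" "q \<le> 4 * v" "5 / 9 * u \<le> p"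
    for p q u v w :: real
    using that by linarith
  ultimately show ?thesis by blast
qed

text \<open>Here \<open>p\<close> and \<open>q\<close> are the scaled two-neighbour thresholds of
  the two vertices, and \<open>p * q\<close> is the area where both are surely matched. Equality
  holds for \<open>p = 0\<close>, \<open>q = 1\<close>.\<close>

lemma threshold_tradeoff_unit:
  fixes p q :: real
  assumes "0 \<le> p" "p \<le> 1" "0 \<le> q" "q \<le> 1"
  shows "5 / 108 * ((1 - p) ^ 3 + (1 - q) ^ 3) + p * q / 2 \<ge> 5 / 108"
proof -
  have bern: "(1 - u) ^ 3 \<ge> 1 - 3 * u" if "u \<le> 1" for u :: real
  proof -
    have "(1 - u) ^ 3 - (1 - 3 * u) = u ^ 2 * (3 - u)" by (simp add: power2_eq_square power3_eq_cube algebra_simps)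
    then show ?thesis using that by (metis diff_ge_0_iff_ge zero_le_mult_iff zero_le_power2 dual_order.trans one_le_numeral)
  qed
  have pos: "0 \<le> (1 - p) ^ 3" "0 \<le> (1 - q) ^ 3" using assms by auto
  \<comment> \<open>At 5/18 the slope \<open>p / 2\<close> of the product in \<open>q\<close> equals
    the slope \<open>3 * 5 / 108\<close> lost by the tangent of the cube.\<close>
  consider "5 / 18 \<le> p" | "5 / 18 \<le> q" | "p \<le> 5 / 18" "q \<le> 5 / 18" by linarith
  then show ?thesis
  proof cases
    case 1
    then have "5 / 18 * q \<le> p * q" using assms by (intro mult_right_mono) auto
    with bern[OF assms(4)] pos show ?thesis by argo
  next
    case 2
    then have "5 / 18 * p \<le> p * q" using assms by (subst mult.commute[of p]) (intro mult_right_mono, auto)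
    with bern[OF assms(2)] pos show ?thesis by argo
  next
    case 3
    have "0 \<le> (5 / 18 - p) * (5 / 18 - q)" using 3 by (intro mult_nonneg_nonneg) auto
    then have "p * q \<ge> 5 / 18 * (p + q) - 25 / 324" by (simp add: algebra_simps)
    with bern[OF assms(2)] bern[OF assms(4)] assms show ?thesis by argo
  qed
qed

lemma threshold_tradeoff:
  fixes N p q :: real
  assumes "0 \<le> p" "p \<le> N" "0 \<le> q" "q \<le> N"
  shows "5 / 108 * ((N - p) ^ 3 + (N - q) ^ 3) + N * p * q / 2 \<ge> 5 / 108 * N ^ 3"
proof (cases "N = 0")
  case False
  then have N: "N > 0" using assms by linarith
  have "5 / 108 * N ^ 3 \<le> N ^ 3 * (5 / 108 * ((1 - p / N) ^ 3 + (1 - q / N) ^ 3) + p / N * (q / N) / 2)"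
    using threshold_tradeoff_unit[of "p / N" "q / N"] assms N
    by (subst mult.commute) (intro mult_left_mono, auto)
  also have "\<dots> = 5 / 108 * ((N * (1 - p / N)) ^ 3 + (N * (1 - q / N)) ^ 3) + N * p * q / 2"
    using N by (simp add: field_simps power3_eq_cube)
  also have "N * (1 - p / N) = N - p" using N by (simp add: field_simps)
  also have "N * (1 - q / N) = N - q" using N by (simp add: field_simps)
  finally show ?thesis .
qed (use assms in auto)

section \<open>Resampling ranks\<close>

text \<open>Exchanging the fresh value \<open>s\<close> with the old value \<open>r v\<close> is an
  involution on the pairs \<open>(r, s)\<close>.\<close>

lemma sum_PiE_resample:
  fixes f :: "('a \<Rightarrow> nat) \<Rightarrow> real"
  assumes "finite V" "v \<in> V"
  shows "real N * (\<Sum>r\<in>PiE V (\<lambda>_. {..<N}). f r) = (\<Sum>r\<in>PiE V (\<lambda>_. {..<N}). \<Sum>s<N. f (r(v := s)))"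
proof -
  let ?G = "PiE V (\<lambda>_. {..<N})"
  let ?swap = "\<lambda>(r, s). (r(v := s), r v)"
  have upd: "r(v := s) \<in> ?G" if "r \<in> ?G" "s < N" for r s
    using PiE_fun_upd[of s "\<lambda>_. {..<N}" v r V] that assms(2) by (simp add: insert_absorb)
  have "(\<Sum>r\<in>?G. \<Sum>s<N. f (r(v := s))) = (\<Sum>(r, s)\<in>?G \<times> {..<N}. f (r(v := s)))"
    by (simp add: sum.cartesian_product)
  also have "\<dots> = (\<Sum>(r, s)\<in>?G \<times> {..<N}. f r)"
    by (rule sum.reindex_bij_witness[of _ ?swap ?swap]) (use upd assms(2) in \<open>auto dest: PiE_mem\<close>)
  also have "\<dots> = real N * (\<Sum>r\<in>?G. f r)"
    by (simp add: sum.cartesian_product[symmetric] sum_distrib_left)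
  finally show ?thesis ..
qed

context ranked_graph
begin

abbreviation grid :: "nat \<Rightarrow> ('a \<Rightarrow> nat) set" where
  "grid N \<equiv> PiE V (\<lambda>_. {..<N})"

lemma grid_less: "r \<in> grid N \<Longrightarrow> v \<in> V \<Longrightarrow> r v < N"
  by (auto dest: PiE_mem)

lemma finite_grid: "finite (grid N)"
  using finite_V by (intro finite_PiE) auto

definition both :: "('a \<Rightarrow> nat) \<Rightarrow> 'a \<Rightarrow> 'a \<Rightarrow> real" where
  "both r c d = of_bool (mt r c \<and> mt r d)"

lemma gap_sum_cases:
  obtains "gap_sum r c = 0" "\<nexists>u. ch r c u" | u where "ch r c u" "gap_sum r c = real (r u) - real (r c)"
proof (cases "\<exists>u. ch r c u")
  case True
  then obtain u where u: "ch r c u" by blast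
  then have "{u\<in>V. ch r c u} = {u}"
    using chooses_fun[OF inj_key] chooses_remaining(5) by blast
  with u that(2) show thesis by (simp add: gap_sum_def)
qed (use that in \<open>simp add: gap_sum_def\<close>)

lemma gap_sum_le: "r \<in> grid N \<Longrightarrow> gap_sum r c \<le> real N * of_bool (mt r c)"
proof (cases rule: gap_sum_cases[of r c])
  case (2 u)
  moreover assume "r \<in> grid N"
  ultimately show ?thesis
    using grid_less[of r N u] chooses_remaining(5)[OF 2(1)] by (auto simp: matched_def)
qed auto

text \<open>Each rank strictly inside the gap is a value of \<open>r d\<close> that makes both ends
  matched; counting only interior ranks costs 1 per rank function. Recording that \<open>d\<close>
  then comes after \<open>c\<close> pays off in \<open>sum_ordered_both_le\<close>.\<close>

lemma sum_gap_le:
  assumes cd: "c \<in> V" "d \<in> V" "{c, d} \<in> E"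
  shows "(\<Sum>r\<in>grid N. gap_sum r c * of_bool (\<not> mt r d)) \<le>
    real N * (\<Sum>r\<in>grid N. both r c d * of_bool (r c < r d)) + real (card (grid N))"
proof -
  let ?H = "\<lambda>r. both r c d * of_bool (r c < r d)"
  have neq: "c \<noteq> d" using cd no_loop by auto
  have "gap_sum r c * of_bool (\<not> mt r d) \<le> (\<Sum>s<N. ?H (r(d := s))) + 1" if r: "r \<in> grid N" for r
  proof (cases "mt r d")
    case False
    show ?thesis
    proof (cases rule: gap_sum_cases[of r c])
      case (2 u)
      have u: "u \<in> V" using chooses_remaining(5)[OF 2(1)] .
      have ud: "u \<noteq> d" using False 2 by (auto simp: matched_def)
      have hit: "?H (r(d := s)) = 1" if "r c < s" "s < r u" for s
      proof -
        have "key (r(d := s)) c = key r c" "key (r(d := s)) u = key r u"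
          using neq ud by (auto simp: key_def)
        then have gap: "key r c < key (r(d := s)) d" "key (r(d := s)) d < key r u"
          using key_less[of c "r(d := s)" d] key_less[of d "r(d := s)" u] cd(1,2) that neq ud by auto
        have "mt (r(d := s)) c \<and> mt (r(d := s)) d"
          by (rule matched_of_move_into_gap[OF inj_key inj_key cd 2(1) False _ gap]) (auto simp: key_def)
        then show ?thesis using that neq by (simp add: both_def)
      qed
      have "real (r u) - real (r c) - 1 \<le> real (card {r c<..<r u})"
        by (cases "r c < r u") auto
      also have "\<dots> = (\<Sum>s\<in>{r c<..<r u}. ?H (r(d := s)))"
        using hit by simp
      also have "\<dots> \<le> (\<Sum>s<N. ?H (r(d := s)))"
        using grid_less[OF r u] by (intro sum_mono2) (auto simp: both_def)
      finally show ?thesis using False 2 by simp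
    qed (auto simp: both_def intro!: sum_nonneg add_nonneg_nonneg)
  qed (auto simp: both_def intro!: sum_nonneg add_nonneg_nonneg)
  then have "(\<Sum>r\<in>grid N. gap_sum r c * of_bool (\<not> mt r d)) \<le> (\<Sum>r\<in>grid N. (\<Sum>s<N. ?H (r(d := s))) + 1)"
    by (intro sum_mono)
  also have "\<dots> = real N * (\<Sum>r\<in>grid N. ?H r) + real (card (grid N))"
    using sum_PiE_resample[OF finite_V cd(2), of N ?H] by (simp add: sum.distrib)
  finally show ?thesis .
qed

text \<open>The weight \<open>N / 2\<close> is the largest possible margin, so a pair with both ends
  matched meets any lower bound that forced gaps would give.\<close>

definition potential :: "nat \<Rightarrow> ('a \<Rightarrow> nat) \<Rightarrow> 'a \<Rightarrow> 'a \<Rightarrow> real" where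
  "potential N r c d = charge r c d + charge r d c + real N / 2 * both r c d"

lemma potential_commute: "potential N r c d = potential N r d c"
  by (simp add: potential_def both_def conj_commute)

lemma potential_nonneg: "0 \<le> potential N r c d"
  by (simp add: potential_def both_def charge_nonneg)

lemma potential_ge:
  assumes cd: "c \<in> V" "d \<in> V" "{c, d} \<in> E" and r: "r d < r c" "r c < N"
    and two: "\<And>s. s < N \<Longrightarrow> 2 \<le> card (free_nbrs r c d (s * n + idx d)) \<longleftrightarrow> s < \<sigma>"
    and one: "\<And>s. s < N \<Longrightarrow> free_nbrs r c d (s * n + idx d) \<noteq> {} \<longleftrightarrow> s < \<tau>"
    and \<sigma>: "\<sigma> \<le> r d" "\<tau> \<le> N"
  shows "margin \<sigma> \<tau> (r d) (r c) - 1 \<le> potential N r c d"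
proof (cases "mt r c \<and> mt r d")
  case True
  then have "real N / 2 \<le> potential N r c d"
    using charge_nonneg[of r c d] charge_nonneg[of r d c] by (simp add: potential_def both_def)
  moreover have "margin \<sigma> \<tau> (r d) (r c) \<le> real N / 2" using r by (intro margin_le) auto
  ultimately show ?thesis by linarith
next
  case False
  then have "potential N r c d = charge r c d + charge r d c" by (simp add: potential_def both_def)
  then show ?thesis
    using charge_region[OF cd r two one \<sigma> False] unfolding margin_def by simp
qed

lemma free_nbrs_thresholds:
  obtains \<sigma> \<tau> where "\<sigma> \<le> \<tau>" "\<tau> \<le> N"
    "\<And>s. s < N \<Longrightarrow> 2 \<le> card (free_nbrs r c d (s * n + idx d)) \<longleftrightarrow> s < \<sigma>"
    "\<And>s. s < N \<Longrightarrow> free_nbrs r c d (s * n + idx d) \<noteq> {} \<longleftrightarrow> s < \<tau>"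
proof -
  let ?F = "\<lambda>s. free_nbrs r c d (s * n + idx d)"
  have mono: "?F t \<subseteq> ?F s" if "s \<le> t" for s t
    using that by (intro free_nbrs_antimono add_right_mono mult_le_mono1)
  have mono2: "2 \<le> card (?F s)" if "s \<le> t" "2 \<le> card (?F t)" for s t
    using card_mono[OF finite_free_nbrs mono[OF that(1)]] that(2) by linarith
  have mono1: "?F s \<noteq> {}" if "s \<le> t" "?F t \<noteq> {}" for s t
    using mono[OF that(1)] that(2) by auto
  obtain \<sigma> where \<sigma>: "\<sigma> \<le> N" "\<And>s. s < N \<Longrightarrow> 2 \<le> card (?F s) \<longleftrightarrow> s < \<sigma>"
    using antimono_threshold[of "\<lambda>s. 2 \<le> card (?F s)" N] mono2 by blast
  obtain \<tau> where \<tau>: "\<tau> \<le> N" "\<And>s. s < N \<Longrightarrow> ?F s \<noteq> {} \<longleftrightarrow> s < \<tau>"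
    using antimono_threshold[of "\<lambda>s. ?F s \<noteq> {}" N] mono1 by blast
  have "\<sigma> \<le> \<tau>"
  proof (rule ccontr)
    assume "\<not> \<sigma> \<le> \<tau>"
    then have "\<tau> < N" "\<tau> < \<sigma>" using \<sigma>(1) by auto
    then have "2 \<le> card (?F \<tau>)" "?F \<tau> = {}" using \<sigma>(2)[of \<tau>] \<tau>(2)[of \<tau>] by auto
    then show False by simp
  qed
  then show thesis using that \<sigma> \<tau> by blast
qed

lemma sum_potential_square_ge:
  assumes cd: "c \<in> V" "d \<in> V" "{c, d} \<in> E"
  shows "(\<Sum>s<N. \<Sum>a<N. potential N (r(d := s, c := a)) c d) \<ge> 5 / 108 * real N ^ 3 - 4 * real N ^ 2"
proof -
  have neq: "c \<noteq> d" using cd no_loop by auto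
  obtain \<sigma> \<tau> where d: "\<sigma> \<le> \<tau>" "\<tau> \<le> N"
    "\<And>s. s < N \<Longrightarrow> 2 \<le> card (free_nbrs r c d (s * n + idx d)) \<longleftrightarrow> s < \<sigma>"
    "\<And>s. s < N \<Longrightarrow> free_nbrs r c d (s * n + idx d) \<noteq> {} \<longleftrightarrow> s < \<tau>"
    using free_nbrs_thresholds[of N r c d] by metis
  obtain \<sigma>' \<tau>' where c: "\<sigma>' \<le> \<tau>'" "\<tau>' \<le> N"
    "\<And>s. s < N \<Longrightarrow> 2 \<le> card (free_nbrs r d c (s * n + idx c)) \<longleftrightarrow> s < \<sigma>'"
    "\<And>s. s < N \<Longrightarrow> free_nbrs r d c (s * n + idx c) \<noteq> {} \<longleftrightarrow> s < \<tau>'"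
    using free_nbrs_thresholds[of N r d c] by metis
  have dc: "{d, c} \<in> E" using cd by (simp add: insert_commute)
  \<comment> \<open>The three regions are disjoint: \<open>d\<close> first and past its threshold,
    \<open>c\<close> first and past its threshold, both before their thresholds.\<close>
  let ?f = "\<lambda>s a. of_bool (s < a \<and> \<sigma> \<le> s) * margin \<sigma> \<tau> s a"
  let ?g = "\<lambda>s a. of_bool (a < s \<and> \<sigma>' \<le> a) * margin \<sigma>' \<tau>' a s"
  let ?h = "\<lambda>s a. real N / 2 * (of_bool (s < \<sigma>) * of_bool (a < \<sigma>'))"
  have point: "?f s a + ?g s a + ?h s a - 1 \<le> potential N (r(d := s, c := a)) c d"
    if sa: "s < N" "a < N" for s a
  proof -
    let ?r = "r(d := s, c := a)"
    have fd: "free_nbrs ?r c d t = free_nbrs r c d t" and fc: "free_nbrs ?r d c t = free_nbrs r d c t" for t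
      by (rule free_nbrs_cong; auto)+
    have vals: "?r d = s" "?r c = a" using neq by auto
    consider "s < a" "\<sigma> \<le> s" | "a < s" "\<sigma>' \<le> a" | "s < \<sigma>" "a < \<sigma>'"
      | "\<not> (s < a \<and> \<sigma> \<le> s)" "\<not> (a < s \<and> \<sigma>' \<le> a)" "\<not> (s < \<sigma> \<and> a < \<sigma>')" by blast
    then show ?thesis
    proof cases
      case 1
      then show ?thesis
        using potential_ge[OF cd, of ?r N \<sigma> \<tau>] d sa unfolding fd vals by auto
    next
      case 2
      then show ?thesis
        using potential_ge[OF cd(2,1) dc, of ?r N \<sigma>' \<tau>'] c sa
        unfolding fc vals potential_commute[of N ?r c d] by auto
    next
      case 3
      have "mt ?r d"
        using matched_of_two_free_nbrs[OF cd, of ?r] d(3)[OF sa(1)] 3 unfolding fd vals by simp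
      moreover have "mt ?r c"
        using matched_of_two_free_nbrs[OF cd(2,1) dc, of ?r] c(3)[OF sa(2)] 3 unfolding fc vals by simp
      ultimately have "real N / 2 \<le> potential N ?r c d"
        using charge_nonneg[of ?r c d] charge_nonneg[of ?r d c] by (simp add: potential_def both_def)
      then show ?thesis using 3 by simp
    next
      case 4
      then have "?f s a = 0" "?g s a = 0" "?h s a = 0" by auto
      then show ?thesis using potential_nonneg[of N ?r c d] by linarith
    qed
  qed
  have "(\<Sum>s<N. \<Sum>a<N. ?f s a + ?g s a + ?h s a - 1) \<le> (\<Sum>s<N. \<Sum>a<N. potential N (r(d := s, c := a)) c d)"
    using point by (intro sum_mono) auto
  moreover have "(\<Sum>s<N. \<Sum>a<N. ?f s a + ?g s a + ?h s a - 1) =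
      (\<Sum>a<N. \<Sum>s<N. ?f s a) + (\<Sum>s<N. \<Sum>a<N. ?g s a) + (\<Sum>s<N. \<Sum>a<N. ?h s a) - real N ^ 2"
    by (subst (2) sum.swap) (simp add: sum.distrib sum_subtractf power2_eq_square)
  moreover have "(\<Sum>s<N. \<Sum>a<N. ?h s a) = real N * real \<sigma> * real \<sigma>' / 2"
  proof -
    have "(\<Sum>s<N. of_bool (s < \<sigma>)) = real \<sigma>" if "\<sigma> \<le> N" for \<sigma>
    proof -
      have "(\<Sum>s<N. of_bool (s < \<sigma>)) = (\<Sum>s<\<sigma>. 1 :: real)"
        using that by (intro sum.mono_neutral_cong_right) auto
      then show ?thesis by simp
    qed
    then have "real \<sigma> * real \<sigma>' = (\<Sum>s<N. of_bool (s < \<sigma>)) * (\<Sum>a<N. of_bool (a < \<sigma>'))"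
      using c(1,2) d(1,2) by (metis le_trans)
    also have "\<dots> = (\<Sum>s<N. \<Sum>a<N. of_bool (s < \<sigma>) * of_bool (a < \<sigma>'))"
      by (rule sum_product)
    finally have "real N * real \<sigma> * real \<sigma>' / 2 = real N / 2 * (\<Sum>s<N. \<Sum>a<N. of_bool (s < \<sigma>) * of_bool (a < \<sigma>'))"
      by simp
    also have "\<dots> = (\<Sum>s<N. \<Sum>a<N. ?h s a)" unfolding sum_distrib_left ..
    finally show ?thesis ..
  qed
  moreover have "5 / 108 * ((real N - real \<sigma>) ^ 3 + (real N - real \<sigma>') ^ 3) + real N * real \<sigma> * real \<sigma>' / 2
      \<ge> 5 / 108 * real N ^ 3"
    using c d by (intro threshold_tradeoff) auto
  ultimately show ?thesis
    using sum_margin_ge[OF d(1,2)] sum_margin_ge[OF c(1,2)] zero_le_power2[of "real N"]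
    unfolding distrib_left by linarith
qed

lemma sum_potential_ge:
  assumes cd: "c \<in> V" "d \<in> V" "{c, d} \<in> E" and N: "N > 0"
  shows "(\<Sum>r\<in>grid N. potential N r c d) \<ge> real (card (grid N)) * (5 / 108 * real N - 4)"
proof -
  let ?P = "\<lambda>r. potential N r c d"
  have "real N ^ 2 * (\<Sum>r\<in>grid N. ?P r) = real N * (\<Sum>r\<in>grid N. \<Sum>a<N. ?P (r(c := a)))"
    using sum_PiE_resample[OF finite_V cd(1), of N ?P] by (simp add: power2_eq_square)
  also have "\<dots> = (\<Sum>r\<in>grid N. \<Sum>s<N. \<Sum>a<N. ?P (r(d := s, c := a)))"
    by (rule sum_PiE_resample[OF finite_V cd(2)])
  also have "\<dots> \<ge> (\<Sum>r\<in>grid N. 5 / 108 * real N ^ 3 - 4 * real N ^ 2)"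
    using sum_potential_square_ge[OF cd] by (intro sum_mono)
  also have "(\<Sum>r\<in>grid N. 5 / 108 * real N ^ 3 - 4 * real N ^ 2) =
      real N ^ 2 * (real (card (grid N)) * (5 / 108 * real N - 4))"
    by (simp add: power2_eq_square power3_eq_cube algebra_simps)
  finally show ?thesis using N by simp
qed

lemma sum_gap_sum: "(\<Sum>v\<in>V. passive_gap_sum r v) = (\<Sum>v\<in>V. gap_sum r v)"
proof -
  have "(\<Sum>v\<in>V. passive_gap_sum r v) = (\<Sum>v\<in>V. \<Sum>x\<in>V. if ch r x v then real (r v) - real (r x) else 0)"
    unfolding passive_gap_sum_def using finite_V by (simp add: sum.inter_filter)
  also have "\<dots> = (\<Sum>x\<in>V. \<Sum>v\<in>V. if ch r x v then real (r v) - real (r x) else 0)"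
    by (rule sum.swap)
  also have "\<dots> = (\<Sum>v\<in>V. gap_sum r v)"
    unfolding gap_sum_def using finite_V by (simp add: sum.inter_filter)
  finally show ?thesis .
qed

end

section \<open>Summation over the maximum matching\<close>

text \<open>\<open>VM\<close> are the vertices covered by a matching, and \<open>p\<close> maps each of them to its partner.\<close>

locale ranked_graph_matching = ranked_graph +
  fixes VM :: "'a set" and p :: "'a \<Rightarrow> 'a"
  assumes VM: "VM \<subseteq> V" and p_in: "v \<in> VM \<Longrightarrow> p v \<in> VM" and p_p: "v \<in> VM \<Longrightarrow> p (p v) = v"
    and p_edge: "v \<in> VM \<Longrightarrow> {v, p v} \<in> E"
begin

lemma sum_partner: "(\<Sum>v\<in>VM. f (p v)) = (\<Sum>v\<in>VM. f v)"
  by (rule sum.reindex_bij_witness[of _ p p]) (auto simp: p_in p_p)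

text \<open>Over all of \<open>V\<close>, passive and active gaps have the same sum, so passive gaps
  are paid by the choosers. A chooser in \<open>VM\<close> with unmatched partner is then counted
  twice, once for each kind of gap; the other choosers are bounded by \<open>N\<close> each.\<close>

lemma sum_charge_le:
  assumes r: "r \<in> grid N"
  shows "(\<Sum>v\<in>VM. charge r v (p v)) \<le> 2 * (\<Sum>v\<in>VM. gap_sum r v * of_bool (\<not> mt r (p v)))
    + real N * (\<Sum>v\<in>VM. both r v (p v)) + real N * (\<Sum>v\<in>V - VM. of_bool (mt r v))"
proof -
  have "(\<Sum>v\<in>VM. charge r v (p v)) \<le>
      (\<Sum>v\<in>VM. gap_sum r v * of_bool (\<not> mt r (p v)) + passive_gap_sum r v)"
    by (intro sum_mono) (auto simp: charge_def passive_gap_sum_nonneg)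
  moreover have "(\<Sum>v\<in>VM. passive_gap_sum r v) \<le> (\<Sum>v\<in>V. passive_gap_sum r v)"
    using VM finite_V passive_gap_sum_nonneg by (intro sum_mono2) auto
  moreover have "(\<Sum>v\<in>V. gap_sum r v) = (\<Sum>v\<in>V - VM. gap_sum r v) + (\<Sum>v\<in>VM. gap_sum r v)"
    using VM finite_V by (rule sum.subset_diff)
  moreover have "(\<Sum>v\<in>V - VM. gap_sum r v) \<le> (\<Sum>v\<in>V - VM. real N * of_bool (mt r v))"
    using gap_sum_le[OF r] by (intro sum_mono)
  moreover have "(\<Sum>v\<in>VM. gap_sum r v) \<le>
      (\<Sum>v\<in>VM. gap_sum r v * of_bool (\<not> mt r (p v)) + real N * both r v (p v))"
  proof (intro sum_mono)
    fix v
    show "gap_sum r v \<le> gap_sum r v * of_bool (\<not> mt r (p v)) + real N * both r v (p v)"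
      using gap_sum_le[OF r, of v] by (cases "mt r (p v)") (auto simp: both_def)
  qed
  ultimately show ?thesis
    unfolding sum_gap_sum sum.distrib sum_distrib_left[symmetric] by linarith
qed

text \<open>Of an edge's two ends at most one has the strictly smaller rank, which halves the price
  of resampling.\<close>

lemma sum_ordered_both_le:
  "2 * (\<Sum>v\<in>VM. both r v (p v) * of_bool (r v < r (p v))) \<le> (\<Sum>v\<in>VM. both r v (p v))"
proof -
  let ?f = "\<lambda>v. both r v (p v) * of_bool (r v < r (p v))"
  have "2 * (\<Sum>v\<in>VM. ?f v) = (\<Sum>v\<in>VM. ?f v + ?f (p v))"
    unfolding sum.distrib sum_partner[of ?f] by simp
  also have "\<dots> \<le> (\<Sum>v\<in>VM. both r v (p v))"
    by (intro sum_mono) (auto simp: both_def p_p)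
  finally show ?thesis .
qed

lemma sum_matched:
  "2 * (\<Sum>v\<in>V. of_bool (mt r v)) =
    real (card VM) + (\<Sum>v\<in>VM. both r v (p v)) + 2 * (\<Sum>v\<in>V - VM. of_bool (mt r v))"
proof -
  have "2 * (\<Sum>v\<in>VM. of_bool (mt r v) :: real) = (\<Sum>v\<in>VM. of_bool (mt r v) + of_bool (mt r (p v)))"
    unfolding sum.distrib sum_partner[of "\<lambda>v. of_bool (mt r v) :: real"] by simp
  also have "\<dots> = (\<Sum>v\<in>VM. 1 + both r v (p v))"
  proof (intro sum.cong refl)
    fix v assume v: "v \<in> VM"
    then have "mt r v \<or> mt r (p v)"
      using matched_maximal[OF p_edge[OF v], of V "key r"] VM p_in by blast
    then show "of_bool (mt r v) + of_bool (mt r (p v)) = 1 + both r v (p v)"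
      by (auto simp: both_def)
  qed
  finally have "2 * (\<Sum>v\<in>VM. of_bool (mt r v)) = real (card VM) + (\<Sum>v\<in>VM. both r v (p v))"
    by (simp add: sum.distrib)
  moreover have "(\<Sum>v\<in>V. of_bool (mt r v) :: real) =
      (\<Sum>v\<in>V - VM. of_bool (mt r v)) + (\<Sum>v\<in>VM. of_bool (mt r v))"
    using VM finite_V by (rule sum.subset_diff)
  ultimately show ?thesis by linarith
qed

text \<open>\<open>491 / 972 = 1 / 2 + 5 / 972\<close>: the forced gaps are worth \<open>5 / 108\<close> per pair, and a pair with both
  ends matched pays for at most \<open>9 / 2\<close> of it, which gives a fraction \<open>5 / 486\<close> of such pairs.\<close>

lemma sum_matched_ge:
  assumes N: "N > 0"
  shows "real (card VM) * real (card (grid N)) * (491 / 972 * real N - 1)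
    \<le> real N * (\<Sum>r\<in>grid N. \<Sum>v\<in>V. of_bool (mt r v))"
proof -
  define T where "T = real (card (grid N))"
  define M where "M = real (card VM)"
  define A where "A = (\<Sum>r\<in>grid N. \<Sum>v\<in>VM. both r v (p v))"
  define W :: real where "W = (\<Sum>r\<in>grid N. \<Sum>v\<in>V - VM. of_bool (mt r v))"
  define G where "G = (\<Sum>r\<in>grid N. \<Sum>v\<in>VM. gap_sum r v * of_bool (\<not> mt r (p v)))"
  define C where "C = (\<Sum>r\<in>grid N. \<Sum>v\<in>VM. charge r v (p v))"
  define H where "H = (\<Sum>r\<in>grid N. \<Sum>v\<in>VM. both r v (p v) * of_bool (r v < r (p v)))"
  define S :: real where "S = (\<Sum>r\<in>grid N. \<Sum>v\<in>V. of_bool (mt r v))"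
  have pV: "v \<in> V" "p v \<in> V" if "v \<in> VM" for v using that VM p_in by auto
  have C_le: "C \<le> 2 * G + real N * A + real N * W"
  proof -
    have "C \<le> (\<Sum>r\<in>grid N. 2 * (\<Sum>v\<in>VM. gap_sum r v * of_bool (\<not> mt r (p v)))
        + real N * (\<Sum>v\<in>VM. both r v (p v)) + real N * (\<Sum>v\<in>V - VM. of_bool (mt r v)))"
      unfolding C_def by (rule sum_mono) (rule sum_charge_le)
    then show ?thesis
      unfolding G_def A_def W_def sum.distrib sum_distrib_left[symmetric] .
  qed
  have "G = (\<Sum>v\<in>VM. \<Sum>r\<in>grid N. gap_sum r v * of_bool (\<not> mt r (p v)))"
    unfolding G_def by (rule sum.swap)
  also have "\<dots> \<le> (\<Sum>v\<in>VM. real N * (\<Sum>r\<in>grid N. both r v (p v) * of_bool (r v < r (p v))) + T)"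
    unfolding T_def using sum_gap_le pV p_edge by (intro sum_mono) auto
  also have "\<dots> = real N * (\<Sum>v\<in>VM. \<Sum>r\<in>grid N. both r v (p v) * of_bool (r v < r (p v))) + M * T"
    by (simp add: sum.distrib sum_distrib_left M_def)
  also have "(\<Sum>v\<in>VM. \<Sum>r\<in>grid N. both r v (p v) * of_bool (r v < r (p v))) = H"
    unfolding H_def by (rule sum.swap)
  finally have G_le: "G \<le> real N * H + M * T" .
  have "2 * H \<le> A"
    unfolding H_def A_def sum_distrib_left[of 2 _ "grid N"] by (rule sum_mono) (rule sum_ordered_both_le)
  then have H_le: "2 * (real N * H) \<le> real N * A"
    using mult_left_mono[of "2 * H" A "real N"] by (simp add: mult.left_commute)
  have "M * (T * (5 / 108 * real N - 4)) = (\<Sum>v\<in>VM. T * (5 / 108 * real N - 4))"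
    by (simp add: M_def)
  also have "\<dots> \<le> (\<Sum>v\<in>VM. \<Sum>r\<in>grid N. potential N r v (p v))"
    unfolding T_def using sum_potential_ge[OF _ _ _ N] pV p_edge by (intro sum_mono) auto
  also have "\<dots> = (\<Sum>r\<in>grid N. \<Sum>v\<in>VM. potential N r v (p v))"
    by (rule sum.swap)
  also have "\<dots> = (\<Sum>r\<in>grid N. 2 * (\<Sum>v\<in>VM. charge r v (p v)) + real N / 2 * (\<Sum>v\<in>VM. both r v (p v)))"
  proof (intro sum.cong refl)
    fix r
    have "(\<Sum>v\<in>VM. charge r (p v) v) = (\<Sum>v\<in>VM. charge r (p v) (p (p v)))"
      by (intro sum.cong) (auto simp: p_p)
    also have "\<dots> = (\<Sum>v\<in>VM. charge r v (p v))" by (rule sum_partner)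
    finally show "(\<Sum>v\<in>VM. potential N r v (p v)) =
        2 * (\<Sum>v\<in>VM. charge r v (p v)) + real N / 2 * (\<Sum>v\<in>VM. both r v (p v))"
      unfolding potential_def sum.distrib sum_distrib_left[symmetric] by simp
  qed
  also have "\<dots> = 2 * C + real N * A / 2"
    unfolding C_def A_def sum.distrib sum_distrib_left[symmetric] by simp
  finally have main: "M * (T * (5 / 108 * real N - 4)) \<le> 2 * C + real N * A / 2" .
  have "2 * S = (\<Sum>r\<in>grid N. real (card VM) + (\<Sum>v\<in>VM. both r v (p v)) + 2 * (\<Sum>v\<in>V - VM. of_bool (mt r v)))"
    unfolding S_def sum_distrib_left[of 2 _ "grid N"] by (intro sum.cong refl sum_matched)
  also have "\<dots> = M * T + A + 2 * W"
    by (simp add: M_def T_def A_def W_def sum.distrib sum_distrib_left)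
  finally have "real N * (2 * S) = real N * (M * T + A + 2 * W)" by simp
  moreover have "0 \<le> real N * W" unfolding W_def by (intro mult_nonneg_nonneg sum_nonneg) auto
  moreover have "0 \<le> M * T" by (simp add: M_def T_def)
  \<comment> \<open>Together \<open>2 * C\<close> is at most
    \<open>4 * N * A + 2 * N * W + 4 * M * T\<close>, so \<open>main\<close> charges
    \<open>9 / 2\<close> to \<open>A\<close>. The term in \<open>W\<close> is absorbed by the
    \<open>2 * W\<close> in \<open>2 * S\<close>, and the constants add up to \<open>8 / 9\<close>
    of \<open>M * T\<close>, below the allowed 1.\<close>
  ultimately have "M * T * (491 / 972 * real N - 1) \<le> real N * S"
    using C_le G_le H_le main by (simp add: algebra_simps)
  then show ?thesis by (simp add: M_def T_def S_def)
qed

end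

section \<open>From ranks to permutations\<close>

lemma filter_less_Suc_sorted:
  fixes k :: "'a \<Rightarrow> nat"
  assumes "sorted (map k xs)"
  shows "filter (\<lambda>v. k v < Suc t) xs = filter (\<lambda>v. k v < t) xs @ filter (\<lambda>v. k v = t) xs"
  using assms
proof (induction xs)
  case (Cons x xs)
  then have "filter (\<lambda>v. k v < t) xs = []" if "\<not> k x < t"
    using that by (fastforce simp: filter_empty_conv)
  with Cons show ?case
    by (cases "k x < t"; cases "k x = t") (auto simp: less_Suc_eq)
qed simp

lemma filter_eq_singleton:
  assumes "distinct xs" "x \<in> set xs"
  shows "filter (\<lambda>v. v = x) xs = [x]"
  using assms by (induction xs) (auto simp: filter_empty_conv)

lemma find_sorted_least:
  fixes k :: "'a \<Rightarrow> nat"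
  assumes "sorted_wrt (\<lambda>x y. k x < k y) xs" "y \<in> set xs" "P y" "\<And>u. u \<in> set xs \<Longrightarrow> P u \<Longrightarrow> k y \<le> k u"
  shows "find P xs = Some y"
  using assms
proof (induction xs)
  case (Cons x xs)
  then show ?case by (cases "x = y") (auto dest: leD)
qed simp

context loopless
begin

lemma fold_ranking_step_eq:
  assumes \<pi>: "set \<pi> = V" "sorted_wrt (\<lambda>x y. k x < k y) \<pi>"
  shows "fold (ranking_step E \<pi>) (filter (\<lambda>v. k v < t) \<pi>) {} =
    {{x, y} |x y. chooses E k V x y \<and> k x < t}"
proof -
  have inj: "inj_on k V" and dist: "distinct \<pi>"
  proof -
    have "sorted_wrt (<) (map k \<pi>)" using \<pi>(2) by (simp add: sorted_wrt_map)
    then have "distinct (map k \<pi>)" by (simp add: strict_sorted_iff)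
    then show "inj_on k V" "distinct \<pi>" using \<pi>(1) by (auto simp: distinct_map)
  qed
  have sorted: "sorted (map k \<pi>)"
    using \<pi>(2) by (auto simp: sorted_wrt_map intro: sorted_wrt_mono_rel[rotated])
  let ?M = "\<lambda>t. {{x, y} |x y. chooses E k V x y \<and> k x < t}"
  have free: "v \<in> \<Union>(?M t) \<longleftrightarrow> v \<notin> remaining E k V t" if "v \<in> V" "t \<le> k v" for v t
  proof
    assume "v \<in> \<Union>(?M t)"
    then show "v \<notin> remaining E k V t" using chooses_gone by blast
  next
    assume "v \<notin> remaining E k V t"
    then obtain x where "chooses E k V x v" "k x < t"
      using remaining_exit[OF \<open>v \<in> V\<close>, of E k t] \<open>t \<le> k v\<close> by blast
    then show "v \<in> \<Union>(?M t)" by blast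
  qed
  \<comment> \<open>The algorithm also searches processed vertices. A processed neighbour of a free
    vertex is always matched, since at its turn it could have chosen that vertex.\<close>
  have cand: "u \<notin> \<Union>(?M t) \<longleftrightarrow> u \<in> remaining E k V t"
    if x: "x \<in> remaining E k V t" and u: "u \<in> V" "{x, u} \<in> E" for x u t
  proof (cases "t \<le> k u")
    case True
    then show ?thesis using free u by blast
  next
    case False
    have "u \<in> \<Union>(?M t)"
    proof (cases "u \<in> remaining E k V (k u)")
      case True
      moreover have "x \<in> remaining E k V (k u)"
        using x remaining_antimono[of "k u" t E k V] False by auto
      ultimately obtain y where "chooses E k V u y"
        using active_chooses[of u k V x] u(2) by (metis insert_commute)
      moreover have "k u < t" using False by simp
      ultimately show ?thesis by blast
    next
      case 2: False
      then obtain x' where "chooses E k V x' u" "k x' < k u"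
        using remaining_exit[OF u(1) 2] by auto
      moreover from this have "k x' < t" using False by simp
      ultimately show ?thesis by blast
    qed
    moreover have "u \<notin> remaining E k V t" using False remaining_key[of u E k V t] by auto
    ultimately show ?thesis by blast
  qed
  show ?thesis
  proof (induction t)
    case (Suc t)
    have split: "fold (ranking_step E \<pi>) (filter (\<lambda>v. k v < Suc t) \<pi>) {} =
        fold (ranking_step E \<pi>) (filter (\<lambda>v. k v = t) \<pi>) (?M t)"
      unfolding filter_less_Suc_sorted[OF sorted] fold_append comp_apply Suc ..
    show ?case
    proof (cases "\<exists>x\<in>V. k x = t")
      case False
      then have "filter (\<lambda>v. k v = t) \<pi> = []" using \<pi>(1) by (auto simp: filter_empty_conv)
      moreover have "chooses E k V x y \<and> k x < Suc t \<longleftrightarrow> chooses E k V x y \<and> k x < t" for x y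
        using False chooses_remaining(4)[of k V x y] less_Suc_eq by auto
      then have "?M (Suc t) = ?M t" by simp
      ultimately show ?thesis unfolding split by simp
    next
      case True
      then obtain x where x: "x \<in> V" "k x = t" by blast
      have "filter (\<lambda>v. k v = t) \<pi> = filter (\<lambda>v. v = x) \<pi>"
        using x inj \<pi>(1) by (intro filter_cong) (auto dest: inj_onD)
      also have "\<dots> = [x]" using dist x \<pi>(1) by (intro filter_eq_singleton) auto
      finally have "fold (ranking_step E \<pi>) (filter (\<lambda>v. k v < Suc t) \<pi>) {} = ranking_step E \<pi> x (?M t)"
        unfolding split by simp
      moreover have "?M (Suc t) = ?M t \<union> {{x, y} |y. chooses E k V x y}"
      proof -
        have "chooses E k V z y \<and> k z < Suc t \<longleftrightarrow> chooses E k V z y \<and> k z < t \<or> z = x \<and> chooses E k V x y" for z y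
          using x inj chooses_remaining(4)[of k V z y] by (auto simp: less_Suc_eq dest: inj_onD)
        then show ?thesis by auto
      qed
      moreover have "ranking_step E \<pi> x (?M t) = ?M t \<union> {{x, y} |y. chooses E k V x y}"
      proof (cases "x \<in> remaining E k V t")
        case False
        then have "x \<in> \<Union>(?M t)" "\<nexists>y. chooses E k V x y"
          using free[of x t] x chooses_remaining(1) by auto
        then show ?thesis by (simp add: ranking_step_def)
      next
        case xr: True
        then have xM: "x \<notin> \<Union>(?M t)" using free[of x t] x by simp
        let ?P = "\<lambda>u. {x, u} \<in> E \<and> u \<notin> \<Union>(?M t)"
        have P: "?P u \<longleftrightarrow> {x, u} \<in> E \<and> u \<in> remaining E k V t" if "u \<in> V" for u
          using cand[OF xr that] by blast
        show ?thesis
        proof (cases "\<exists>y. chooses E k V x y")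
          case True
          then obtain y where y: "chooses E k V x y" by blast
          have yr: "y \<in> V" "{x, y} \<in> E" "y \<in> remaining E k V t" using chooses_remaining[OF y] x by auto
          have find: "find ?P \<pi> = Some y"
          proof (rule find_sorted_least[OF \<pi>(2)])
            show "y \<in> set \<pi>" "?P y" using yr P[of y] \<pi>(1) by auto
            show "k y \<le> k u" if "u \<in> set \<pi>" "?P u" for u
              using y P[of u] that \<pi>(1) x by (auto simp: chooses_def first_nbr_def)
          qed
          have "ranking_step E \<pi> x (?M t) = insert {x, y} (?M t)"
            unfolding ranking_step_def by (simp only: xM find option.case if_False)
          moreover have "{{x, y} |y. chooses E k V x y} = {{x, y}}"
            using y chooses_fun[OF inj] by blast
          ultimately show ?thesis by simp
        next
          case False
          have "\<not> ?P u" if "u \<in> set \<pi>" for u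
            using active_chooses[of x k V u] P[of u] False that \<pi>(1) xr x by auto
          then have find: "find ?P \<pi> = None" by (simp only: find_None_iff) blast
          have "ranking_step E \<pi> x (?M t) = ?M t"
            unfolding ranking_step_def by (simp only: xM find option.case if_False)
          with False show ?thesis by simp
        qed
      qed
      ultimately show ?thesis by simp
    qed
  qed simp
qed

lemma ranking_eq_chooses:
  assumes "set \<pi> = V" "sorted_wrt (\<lambda>x y. k x < k y) \<pi>"
  shows "ranking E \<pi> = {{x, y} |x y. chooses E k V x y}"
proof -
  obtain t where t: "\<And>v. v \<in> V \<Longrightarrow> k v < t"
    using finite_nat_set_iff_bounded[of "k ` V"] assms(1) by auto
  then have "filter (\<lambda>v. k v < t) \<pi> = \<pi>" using assms(1) by (simp add: filter_id_conv)
  moreover have "{{x, y} |x y. chooses E k V x y \<and> k x < t} = {{x, y} |x y. chooses E k V x y}"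
    using t chooses_remaining(4) by blast
  ultimately show ?thesis using fold_ranking_step_eq[OF assms, of t] by (simp add: ranking_def)
qed

lemma card_matched_eq:
  assumes "set \<pi> = V" "sorted_wrt (\<lambda>x y. k x < k y) \<pi>"
  shows "card {v\<in>V. matched E k V v} = 2 * card (ranking E \<pi>)"
proof -
  have eq: "ranking E \<pi> = {{x, y} |x y. chooses E k V x y}" using ranking_eq_chooses[OF assms] .
  have "{v\<in>V. matched E k V v} = \<Union>(ranking E \<pi>)"
    unfolding eq matched_def using chooses_remaining(4,5) by blast
  moreover have "ranking E \<pi> \<subseteq> Pow V" unfolding eq using chooses_remaining(4,5) by blast
  then have "finite (ranking E \<pi>)" using assms(1) by (metis finite_Pow_iff finite_set finite_subset)
  moreover have "card e = 2" if "e \<in> ranking E \<pi>" for e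
    using that chooses_remaining(6) unfolding eq by force
  moreover have "pairwise disjnt (ranking E \<pi>)" using matching_ranking[of E \<pi>] by (simp add: matching_def)
  ultimately show ?thesis
    using card_Union_disjoint[of "ranking E \<pi>"] by (simp add: card_ge_0_finite)
qed

end

section \<open>Uniform random orders from independent ranks\<close>

lemma card_ranks_sorted_along:
  assumes "distinct \<pi>" "set \<pi> = V"
  shows "card {r\<in>PiE V (\<lambda>_. {..<N}). sorted_wrt (<) (map r \<pi>)} =
    card {xs :: nat list. length xs = card V \<and> set xs \<subseteq> {..<N} \<and> sorted_wrt (<) xs}"
proof (rule bij_betw_same_card[of "\<lambda>r. map r \<pi>"])
  let ?S = "{r\<in>PiE V (\<lambda>_. {..<N}). sorted_wrt (<) (map r \<pi>)}"
  let ?L = "{xs :: nat list. length xs = card V \<and> set xs \<subseteq> {..<N} \<and> sorted_wrt (<) xs}"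
  have len: "length \<pi> = card V" using assms by (metis distinct_card)
  show "bij_betw (\<lambda>r. map r \<pi>) ?S ?L"
  proof (rule bij_betwI')
    fix r r' assume "r \<in> ?S" "r' \<in> ?S"
    then show "(map r \<pi> = map r' \<pi>) = (r = r')" using assms(2) by (auto intro: PiE_ext)
  next
    fix r assume "r \<in> ?S"
    then show "map r \<pi> \<in> ?L" using assms(2) len by (auto simp: PiE_mem)
  next
    fix xs assume xs: "xs \<in> ?L"
    define r where "r = restrict (\<lambda>v. the (map_of (zip \<pi> xs) v)) V"
    have map: "map r \<pi> = xs"
    proof (rule nth_equalityI)
      fix i assume "i < length (map r \<pi>)"
      then show "map r \<pi> ! i = xs ! i"
        using assms xs len by (auto simp: r_def map_of_zip_nth)
    qed (use xs len in simp)
    then have "r ` V \<subseteq> {..<N}" using xs assms(2) by (metis (mono_tags, lifting) list.set_map mem_Collect_eq)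
    then have "r \<in> ?S" using map xs by (auto simp: r_def PiE_def)
    then show "\<exists>r\<in>?S. xs = map r \<pi>" using map by blast
  qed
qed

text \<open>Union bound over pairs: resampling \<open>r u\<close> hits the value \<open>r v\<close>
  for at most one of the \<open>N\<close> choices.\<close>

lemma card_ranks_not_inj:
  assumes "finite V"
  shows "real N * real (card {r\<in>PiE V (\<lambda>_. {..<N}). \<not> inj_on r V}) \<le>
    real (card V) ^ 2 * real (card (PiE V (\<lambda>_. {..<N})))"
proof -
  let ?G = "PiE V (\<lambda>_. {..<N})"
  let ?D = "{(u, v)\<in>V \<times> V. u \<noteq> v}"
  have fin: "finite ?G" using assms by (intro finite_PiE) auto
  have D: "finite ?D" "card ?D \<le> card V ^ 2"
    using assms card_mono[of "V \<times> V" ?D] finite_subset[of ?D "V \<times> V"]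
    by (auto simp: card_cartesian_product power2_eq_square)
  have eq: "real N * real (card {r\<in>?G. r u = r v}) \<le> real (card ?G)" if "u \<in> V" "v \<in> V" "u \<noteq> v" for u v
  proof -
    have "real N * real (card {r\<in>?G. r u = r v}) = real N * (\<Sum>r\<in>?G. of_bool (r u = r v))"
      using fin by (simp add: Int_def conj_commute)
    also have "\<dots> = (\<Sum>r\<in>?G. \<Sum>s<N. of_bool (s = r v))"
      using sum_PiE_resample[OF assms that(1), of N "\<lambda>r. of_bool (r u = r v)"] that(3) by simp
    also have "\<dots> \<le> (\<Sum>r\<in>?G. 1)"
    proof (rule sum_mono)
      fix r
      have "card ({..<N} \<inter> {s. s = r v}) \<le> card {r v}" by (intro card_mono) auto
      then show "(\<Sum>s<N. of_bool (s = r v)) \<le> (1 :: real)" by simp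
    qed
    finally show ?thesis by simp
  qed
  have "{r\<in>?G. \<not> inj_on r V} = (\<Union>(u, v)\<in>?D. {r\<in>?G. r u = r v})"
    by (auto simp: inj_on_def)
  then have "card {r\<in>?G. \<not> inj_on r V} \<le> (\<Sum>(u, v)\<in>?D. card {r\<in>?G. r u = r v})"
    using card_UN_le[OF D(1), of "\<lambda>(u, v). {r\<in>?G. r u = r v}"] by (simp add: case_prod_unfold)
  then have "real N * real (card {r\<in>?G. \<not> inj_on r V}) \<le>
      real N * (\<Sum>(u, v)\<in>?D. real (card {r\<in>?G. r u = r v}))"
    by (intro mult_left_mono) (simp_all add: case_prod_unfold flip: of_nat_sum)
  also have "\<dots> = (\<Sum>(u, v)\<in>?D. real N * real (card {r\<in>?G. r u = r v}))"
    by (simp add: sum_distrib_left case_prod_unfold)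
  also have "\<dots> \<le> (\<Sum>(u, v)\<in>?D. real (card ?G))"
    using eq by (intro sum_mono) auto
  also have "\<dots> = real (card ?D) * real (card ?G)"
    by (simp add: case_prod_unfold)
  also have "\<dots> \<le> real (card V ^ 2) * real (card ?G)"
    using D(2) by (intro mult_right_mono) (simp_all only: of_nat_le_iff of_nat_0_le_iff)
  finally show ?thesis by simp
qed

lemma ex_sorted_order:
  fixes r :: "'a \<Rightarrow> nat"
  assumes "finite V" "inj_on r V"
  shows "\<exists>\<pi>\<in>permutations_of_set V. sorted_wrt (<) (map r \<pi>)"
proof -
  let ?xs = "sorted_list_of_set (r ` V)"
  let ?\<pi> = "map (inv_into V r) ?xs"
  have fin: "finite (r ` V)" using assms by simp
  have "map r ?\<pi> = ?xs"
    unfolding map_map by (rule map_idI) (use fin in \<open>auto simp: f_inv_into_f\<close>)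
  moreover have "set ?\<pi> = V" using assms by simp
  moreover have "distinct ?\<pi>"
    using fin by (simp add: distinct_map inj_on_inv_into)
  ultimately show ?thesis
    by (intro bexI[of _ ?\<pi>]) (simp_all add: permutations_of_set_def)
qed

lemma sorted_order_unique:
  fixes r :: "'a \<Rightarrow> nat"
  assumes "sorted_wrt (<) (map r \<pi>)" "sorted_wrt (<) (map r \<pi>')" "set \<pi> = set \<pi>'"
  shows "\<pi> = \<pi>'"
proof -
  have "map r \<pi> = map r \<pi>'"
    by (rule strict_sorted_equal) (use assms in auto)
  moreover have "inj_on r (set \<pi> \<union> set \<pi>')"
    using assms by (auto simp: strict_sorted_iff distinct_map)
  ultimately show ?thesis using map_inj_on by blast
qed

text \<open>Injective ranks induce a uniform order, and the rare ties are paid by the bound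
  \<open>B\<close>. As \<open>h\<close> is nonnegative, the number of injective rank functions may
  be replaced by that of all.\<close>

lemma sum_over_ranks_le:
  fixes h :: "'a list \<Rightarrow> real" and f :: "('a \<Rightarrow> nat) \<Rightarrow> real"
  assumes V: "finite V" and N: "N > 0" and h: "\<And>\<pi>. 0 \<le> h \<pi>"
    and f: "\<And>r \<pi>. \<pi> \<in> permutations_of_set V \<Longrightarrow> sorted_wrt (<) (map r \<pi>) \<Longrightarrow> f r = h \<pi>"
    and bound: "\<And>r. f r \<le> B" "0 \<le> B"
  shows "(\<Sum>r\<in>PiE V (\<lambda>_. {..<N}). f r) \<le> real (card (PiE V (\<lambda>_. {..<N}))) *
    (measure_pmf.expectation (pmf_of_set (permutations_of_set V)) h + B * real (card V) ^ 2 / real N)"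
proof -
  let ?G = "PiE V (\<lambda>_. {..<N})"
  let ?P = "permutations_of_set V"
  let ?S = "\<lambda>\<pi>. {r\<in>?G. sorted_wrt (<) (map r \<pi>)}"
  define K where "K = card {xs :: nat list. length xs = card V \<and> set xs \<subseteq> {..<N} \<and> sorted_wrt (<) xs}"
  define e where "e = (\<Sum>\<pi>\<in>?P. h \<pi>) / real (card ?P)"
  have fin: "finite ?G" using V by (intro finite_PiE) auto
  have P: "finite ?P" "?P \<noteq> {}" using V by auto
  have e: "measure_pmf.expectation (pmf_of_set ?P) h = e"
    using P by (simp add: integral_pmf_of_set e_def)
  \<comment> \<open>The same count for every order: this is the uniformity.\<close>
  have K: "card (?S \<pi>) = K" if "\<pi> \<in> ?P" for \<pi>
    using card_ranks_sorted_along[of \<pi> V N] that by (simp add: permutations_of_set_def K_def)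
  have disj: "disjoint_family_on ?S ?P"
    using sorted_order_unique by (fastforce simp: disjoint_family_on_def permutations_of_set_def)
  have inj_eq: "{r\<in>?G. inj_on r V} = (\<Union>\<pi>\<in>?P. ?S \<pi>)"
  proof -
    have "inj_on r V" if "\<pi> \<in> ?P" "sorted_wrt (<) (map r \<pi>)" for r :: "'a \<Rightarrow> nat" and \<pi>
      using that by (auto simp: permutations_of_set_def strict_sorted_iff distinct_map)
    moreover have "\<exists>\<pi>\<in>?P. sorted_wrt (<) (map r \<pi>)" if "inj_on r V" for r :: "'a \<Rightarrow> nat"
      using ex_sorted_order[OF V that] .
    ultimately show ?thesis by auto
  qed
  have "(\<Sum>r\<in>?G. f r) = (\<Sum>r\<in>{r\<in>?G. \<not> inj_on r V}. f r) + (\<Sum>r\<in>{r\<in>?G. inj_on r V}. f r)"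
    using fin by (subst sum.union_disjoint[symmetric]) (auto intro: sum.cong)
  moreover have "(\<Sum>r\<in>{r\<in>?G. \<not> inj_on r V}. f r) \<le> real (card {r\<in>?G. \<not> inj_on r V}) * B"
    using bound(1) by (rule sum_bounded_above)
  moreover have "(\<Sum>r\<in>{r\<in>?G. inj_on r V}. f r) = (\<Sum>\<pi>\<in>?P. \<Sum>r\<in>?S \<pi>. f r)"
    unfolding inj_eq using fin P disj by (intro sum.UNION_disjoint_family) auto
  moreover have "(\<Sum>\<pi>\<in>?P. \<Sum>r\<in>?S \<pi>. f r) = (\<Sum>\<pi>\<in>?P. real K * h \<pi>)"
    using f K by (intro sum.cong refl) simp
  moreover have "(\<Sum>\<pi>\<in>?P. real K * h \<pi>) = real K * real (card ?P) * e"
    using P by (simp add: e_def flip: sum_distrib_left)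
  moreover have "real K * real (card ?P) * e \<le> real (card ?G) * e"
  proof (rule mult_right_mono)
    have "card (\<Union>\<pi>\<in>?P. ?S \<pi>) = (\<Sum>\<pi>\<in>?P. card (?S \<pi>))"
      using fin P disj by (intro card_UN_disjoint') auto
    then have "K * card ?P = card (\<Union>\<pi>\<in>?P. ?S \<pi>)" using K by simp
    also have "\<dots> \<le> card ?G" using fin by (intro card_mono) auto
    finally show "real K * real (card ?P) \<le> real (card ?G)" by (metis of_nat_le_iff of_nat_mult)
    show "0 \<le> e" unfolding e_def using h by (intro divide_nonneg_nonneg sum_nonneg) auto
  qed
  moreover have "real (card {r\<in>?G. \<not> inj_on r V}) * B \<le> real (card ?G) * (B * real (card V) ^ 2 / real N)"
  proof -
    have "real (card {r\<in>?G. \<not> inj_on r V}) \<le> real (card V) ^ 2 * real (card ?G) / real N"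
      using card_ranks_not_inj[OF V, of N] N by (simp add: field_simps)
    from mult_right_mono[OF this bound(2)] show ?thesis by (simp add: mult_ac)
  qed
  ultimately show ?thesis unfolding e distrib_left by linarith
qed

section \<open>Limit of fine grids, and partners in a maximum matching\<close>

lemma le_of_le_add_over_nat:
  fixes a b c :: real
  assumes "\<And>N :: nat. N > 0 \<Longrightarrow> a \<le> b + c / real N"
  shows "a \<le> b"
proof (rule LIMSEQ_le_const)
  show "(\<lambda>N. b + c / real N) \<longlonglongrightarrow> b"
    using tendsto_add[OF tendsto_const lim_const_over_n[of c]] by simp
  show "\<exists>M. \<forall>N\<ge>M. a \<le> b + c / real N"
    using assms by (intro exI[of _ 1]) auto
qed

lemma maximum_matching_exists:
  assumes "finite E"
  obtains M where "matching E M" "card M = matching_number E"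
proof -
  have "finite {card M |M. matching E M}"
    using assms by (auto simp: matching_def intro: finite_subset[of _ "card ` Pow E"])
  moreover have "{card M |M. matching E M} \<noteq> {}"
    by (auto simp: matching_def intro!: exI[of _ "{}"])
  ultimately have "matching_number E \<in> {card M |M. matching E M}"
    unfolding matching_number_def by (rule Max_in)
  then show thesis using that by auto
qed

lemma matching_partner:
  assumes E: "\<And>e. e \<in> E \<Longrightarrow> card e = 2" and M: "matching E M"
  obtains p where "\<And>v. v \<in> \<Union>M \<Longrightarrow> p v \<in> \<Union>M" "\<And>v. v \<in> \<Union>M \<Longrightarrow> p (p v) = v"
    "\<And>v. v \<in> \<Union>M \<Longrightarrow> {v, p v} \<in> E"
proof -
  have uniq: "e = e'" if "v \<in> e" "v \<in> e'" "e \<in> M" "e' \<in> M" for v e e'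
    using M that unfolding matching_def pairwise_def disjnt_def by blast
  have "\<exists>w. {v, w} \<in> M" if "v \<in> \<Union>M" for v
  proof -
    obtain e where e: "e \<in> M" "v \<in> e" using \<open>v \<in> \<Union>M\<close> by blast
    then have "card e = 2" using E M by (auto simp: matching_def)
    then obtain x y where xy: "e = {x, y}" by (auto simp: card_2_iff)
    show ?thesis
    proof (cases "v = x")
      case True
      then show ?thesis using e xy by blast
    next
      case False
      then have "e = {v, x}" using e xy by auto
      then show ?thesis using e by blast
    qed
  qed
  then obtain p where p: "\<And>v. v \<in> \<Union>M \<Longrightarrow> {v, p v} \<in> M" by metis
  show thesis
  proof (rule that[of p])
    fix v assume v: "v \<in> \<Union>M"
    show pv: "p v \<in> \<Union>M" and "{v, p v} \<in> E" using p[OF v] M by (auto simp: matching_def)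
    have "{p v, p (p v)} = {v, p v}" using uniq[of "p v"] p[OF v] p[OF pv] by auto
    moreover have "v \<noteq> p v" using p[OF v] E[of "{v, p v}"] M by (auto simp: matching_def)
    ultimately show "p (p v) = v" by (auto simp: doubleton_eq_iff)
  qed
qed

theorem theorem2p6:
  fixes V :: "'a set" and E :: "'a set set"
  assumes "finite_simple_graph V E"
  shows "measure_pmf.expectation (pmf_of_set (permutations_of_set V))
           (\<lambda>\<pi>. real (card (ranking E \<pi>))) \<ge> 0.505 * real (matching_number E)"
proof -
  have V: "finite V" and E: "\<And>e. e \<in> E \<Longrightarrow> e \<subseteq> V \<and> card e = 2"
    using assms by (auto simp: finite_simple_graph_def)
  then have "finite E" by (meson Pow_iff finite_Pow_iff finite_subset subsetI)
  then obtain M where M: "matching E M" "card M = matching_number E"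
    by (rule maximum_matching_exists)
  obtain p where p: "\<And>v. v \<in> \<Union>M \<Longrightarrow> p v \<in> \<Union>M" "\<And>v. v \<in> \<Union>M \<Longrightarrow> p (p v) = v"
    "\<And>v. v \<in> \<Union>M \<Longrightarrow> {v, p v} \<in> E"
    using matching_partner[of E M] E M(1) by blast
  have ME: "M \<subseteq> E" "pairwise disjnt M" using M(1) by (auto simp: matching_def)
  have "card (\<Union>M) = (\<Sum>e\<in>M. card e)"
    using ME E V by (intro card_Union_disjoint) (auto intro: finite_subset)
  also have "\<dots> = (\<Sum>e\<in>M. 2)" using ME(1) E by (intro sum.cong) auto
  finally have card_VM: "card (\<Union>M) = 2 * matching_number E" using M(2) by simp
  obtain idx :: "'a \<Rightarrow> nat" and n where idx: "idx ` V = {i. i < n}" "inj_on idx V"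
    using finite_imp_inj_to_nat_seg[OF V] by blast
  interpret ranked_graph_matching E V n idx "\<Union>M" p
  proof unfold_locales
    show "{x, x} \<notin> E" for x using E[of "{x, x}"] by auto
    show "\<Union>M \<subseteq> V" using ME(1) E by blast
  qed (use V idx p in auto)
  let ?e = "measure_pmf.expectation (pmf_of_set (permutations_of_set V)) (\<lambda>\<pi>. real (card (ranking E \<pi>)))"
  have matched_eq: "(\<Sum>v\<in>V. of_bool (mt r v)) = 2 * real (card (ranking E \<pi>))"
    if "\<pi> \<in> permutations_of_set V" "sorted_wrt (<) (map r \<pi>)" for r \<pi>
  proof -
    have \<pi>: "set \<pi> = V" using that(1) by (simp add: permutations_of_set_def)
    have "sorted_wrt (\<lambda>x y. r x < r y) \<pi>" using that(2) by (simp add: sorted_wrt_map)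
    then have "sorted_wrt (\<lambda>x y. key r x < key r y) \<pi>"
      by (rule sorted_wrt_mono_rel[rotated]) (use key_less \<pi> in auto)
    then have "card {v\<in>V. mt r v} = 2 * card (ranking E \<pi>)" by (rule card_matched_eq[OF \<pi>])
    then have "real (card {v\<in>V. mt r v}) = 2 * real (card (ranking E \<pi>))" by simp
    then show ?thesis using V by (simp add: Int_def)
  qed
  \<comment> \<open>Both sides are doubled because matched and covered vertices are counted instead
    of edges. The expectation does not depend on the grid, so \<open>N\<close> may tend to
    infinity.\<close>
  have "491 / 972 * (2 * real (matching_number E)) \<le> 2 * ?e"
  proof (rule le_of_le_add_over_nat)
    fix N :: nat assume N: "N > 0"
    let ?T = "real (card (grid N))"
    let ?VM = "2 * real (matching_number E)"
    have T: "?T > 0"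
      using finite_grid[of N] N by (auto simp: card_gt_0_iff PiE_eq_empty_iff)
    have "(\<Sum>r\<in>grid N. \<Sum>v\<in>V. of_bool (mt r v)) \<le>
        ?T * (measure_pmf.expectation (pmf_of_set (permutations_of_set V)) (\<lambda>\<pi>. 2 * real (card (ranking E \<pi>)))
          + real (card V) * real (card V) ^ 2 / real N)"
    proof (rule sum_over_ranks_le[OF V N])
      show "(\<Sum>v\<in>V. of_bool (mt r v)) \<le> real (card V)" for r
        using sum_bounded_above[of V "\<lambda>v. of_bool (mt r v)" "1 :: real"] by simp
    qed (use matched_eq in auto)
    then have "(\<Sum>r\<in>grid N. \<Sum>v\<in>V. of_bool (mt r v)) \<le> ?T * (2 * ?e + real (card V) ^ 3 / real N)"
      by (simp add: power2_eq_square power3_eq_cube mult.assoc)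
    then have "real N * (\<Sum>r\<in>grid N. \<Sum>v\<in>V. of_bool (mt r v)) \<le>
        real N * (?T * (2 * ?e + real (card V) ^ 3 / real N))"
      by (rule mult_left_mono) simp
    with sum_matched_ge[OF N]
    have "?VM * ?T * (491 / 972 * real N - 1) \<le> real N * (?T * (2 * ?e + real (card V) ^ 3 / real N))"
      unfolding card_VM by simp
    then have "?T * (?VM * (491 / 972 * real N - 1)) \<le> ?T * (real N * (2 * ?e + real (card V) ^ 3 / real N))"
      by (simp only: mult_ac)
    then have "?VM * (491 / 972 * real N - 1) \<le> real N * (2 * ?e + real (card V) ^ 3 / real N)"
      using T by (simp only: mult_le_cancel_left_pos)
    also have "\<dots> = real N * (2 * ?e) + real (card V) ^ 3"
      using N by (simp add: distrib_left)
    finally have "?VM * (491 / 972 * real N - 1) \<le> real N * (2 * ?e) + real (card V) ^ 3" .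
    then show "491 / 972 * ?VM \<le> 2 * ?e + (real (card V) ^ 3 + ?VM) / real N"
      using N by (simp add: field_simps)
  qed
  then show ?thesis by simp
qed

end
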